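(* Let $n$ be a positive integer and let $\mathcal{M}$ be an additive category which satisfies the following two axioms: (A0) $\mathcal{M}$ is idempotent complete; (A1) every morphism in $\mathcal{M}$ has an $n$-kernel and an $n$-cokernel. Let $X\colon X^0\xrightarrow{d_X^0}X^1\to\cdots\xrightarrow{d_X^{n-1}}X^n$ be a complex in $\mathcal{M}$ and $f\colon X^0\to Y^0$ a morphism. Then the following statements hold: (i) There exists an $n$-pushout diagram of $X$ along $f$: $$\begin{array}{ccccccccc}X^0&\to&X^1&\to&\cdots&\to&X^{n-1}&\to&X^n\\ {\scriptstyle f}\downarrow&&\downarrow&&&&\downarrow&&\downarrow\\ Y^0&\to&Y^1&\to&\cdots&\to&Y^{n-1}&\to&Y^n\end{array}$$ (ii) Suppose, moreover, that $\mathcal{M}$ is an $n$-abelian category. If $d_X^0$ is a monomorphism, then the morphism $d_Y^0\colon Y^0\to Y^1$ in the diagram of (i) is a monomorphism.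
   Context: Composition is written left to right. **$n$-exact sequences.** In an additive category $\mathcal{C}$, an $n$-cokernel of $d^0\colon X^0\to X^1$ is a sequence $(d^1,\dots,d^n)$, $X^1\to\cdots\to X^{n+1}$, such that $0\to\mathcal{C}(X^{n+1},Y)\to\cdots\to\mathcal{C}(X^1,Y)\to\mathcal{C}(X^0,Y)$ is exact for all $Y\in\mathcal{C}$; dually, an $n$-kernel of $d^n\colon X^n\to X^{n+1}$ is a sequence $(d^0,\dots,d^{n-1})$, $X^0\to\cdots\to X^n$, such that $0\to\mathcal{C}(Y,X^0)\to\cdots\to\mathcal{C}(Y,X^n)\to\mathcal{C}(Y,X^{n+1})$ is exact for all $Y$. An $n$-exact sequence is a complex $X^0\xrightarrow{d^0}\cdots\xrightarrow{d^n}X^{n+1}$ such that $(d^0,\dots,d^{n-1})$ is an $n$-kernel of $d^n$ and $(d^1,\dots,d^n)$ is an $n$-cokernel of $d^0$. **$n$-abelian category.** An additive category satisfying (A0), (A1) and: (A2) for every monomorphism $f^0\colon X^0\to X^1$ and every $n$-cokernel $(f^1,\dots,f^n)$ of $f^0$, the sequence $(f^0,f^1,\dots,f^n)$ is $n$-exact; (A2$^{\mathrm{op}}$) for every epimorphism $g^n\colon X^n\to X^{n+1}$ and every $n$-kernel $(g^0,\dots,g^{n-1})$ of $g^n$, the sequence $(g^0,\dots,g^n)$ is $n$-exact. **$n$-pushout diagram.** Given a complex $X\colon X^0\to\cdots\to X^n$ and $f^0\colon X^0\to Y^0$, an $n$-pushout diagram of $X$ along $f^0$ is a morphism of complexes $f\colon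 X\to Y$, $Y\colon Y^0\to\cdots\to Y^n$, with component $f^0$ in degree $0$, such that in the mapping cone $X^0\xrightarrow{d_C^{-1}}X^1\oplus Y^0\xrightarrow{d_C^0}\cdots\to X^n\oplus Y^{n-1}\xrightarrow{d_C^{n-1}}Y^n$, with $$d_C^k=\begin{bmatrix}-d_X^{k+1}&0\\ f^{k+1}&d_Y^k\end{bmatrix}\colon X^{k+1}\oplus Y^k\to X^{k+2}\oplus Y^{k+1}$$ (acting on columns; in particular $d_C^{-1}=[-d_X^0\ \ f^0]^\top$ and $d_C^{n-1}=[f^n\ \ d_Y^{n-1}]$), the sequence $(d_C^0,\dots,d_C^{n-1})$ is an $n$-cokernel of $d_C^{-1}$. *)

theory Defs
  imports "HOL-Algebra.Exact_Sequence"
begin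

section \<open>Additive categories\<close>

text \<open>
  A category is given by its objects and arrows; the composite \<open>f \<Zcomp> g\<close> is written
  left to right: first \<open>f\<close>, then \<open>g\<close>.  \<open>Plus\<close> adds parallel arrows and \<open>Null A B\<close> is the
  zero arrow from \<open>A\<close> to \<open>B\<close>.
\<close>

record ('o, 'm) precat =
  Obj :: "'o set"
  Arr :: "'m set"
  Dom :: "'m \<Rightarrow> 'o"
  Cod :: "'m \<Rightarrow> 'o"
  Ident :: "'o \<Rightarrow> 'm"
  Comp :: "'m \<Rightarrow> 'm \<Rightarrow> 'm"  (infixl \<open>\<Zcomp>\<index>\<close> 75)
  Plus :: "'m \<Rightarrow> 'm \<Rightarrow> 'm"  (infixl \<open>\<boxplus>\<index>\<close> 65)
  Null :: "'o \<Rightarrow> 'o \<Rightarrow> 'm"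

definition Hom :: "('o, 'm, 'b) precat_scheme \<Rightarrow> 'o \<Rightarrow> 'o \<Rightarrow> 'm set"
  where "Hom M A B = {f \<in> Arr M. Dom M f = A \<and> Cod M f = B}"

definition hom_group :: "('o, 'm, 'b) precat_scheme \<Rightarrow> 'o \<Rightarrow> 'o \<Rightarrow> 'm monoid"
  where "hom_group M A B = \<lparr>carrier = Hom M A B, monoid.mult = Plus M, one = Null M A B\<rparr>"

definition Neg :: "('o, 'm, 'b) precat_scheme \<Rightarrow> 'm \<Rightarrow> 'm"  (\<open>\<boxminus>\<index> _\<close> [81] 80)
  where "Neg M f = m_inv (hom_group M (Dom M f) (Cod M f)) f"

locale category =
  fixes M :: "('o, 'm, 'b) precat_scheme" (structure)
  assumes Dom_closed: "f \<in> Arr M \<Longrightarrow> Dom M f \<in> Obj M"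
    and Cod_closed: "f \<in> Arr M \<Longrightarrow> Cod M f \<in> Obj M"
    and Ident_closed: "A \<in> Obj M \<Longrightarrow> Ident M A \<in> Hom M A A"
    and Comp_closed: "\<lbrakk>f \<in> Hom M A B; g \<in> Hom M B C\<rbrakk> \<Longrightarrow> f \<Zcomp> g \<in> Hom M A C"
    and Comp_assoc:
      "\<lbrakk>f \<in> Hom M A B; g \<in> Hom M B C; h \<in> Hom M C D\<rbrakk> \<Longrightarrow> (f \<Zcomp> g) \<Zcomp> h = f \<Zcomp> (g \<Zcomp> h)"
    and Ident_left: "f \<in> Hom M A B \<Longrightarrow> Ident M A \<Zcomp> f = f"
    and Ident_right: "f \<in> Hom M A B \<Longrightarrow> f \<Zcomp> Ident M B = f"

locale preadditive_category = category +
  assumes hom_comm_group: "\<lbrakk>A \<in> Obj M; B \<in> Obj M\<rbrakk> \<Longrightarrow> comm_group (hom_group M A B)"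
    and Comp_distrib_left:
      "\<lbrakk>f \<in> Hom M A B; g \<in> Hom M B C; h \<in> Hom M B C\<rbrakk> \<Longrightarrow> f \<Zcomp> (g \<boxplus> h) = f \<Zcomp> g \<boxplus> f \<Zcomp> h"
    and Comp_distrib_right:
      "\<lbrakk>f \<in> Hom M A B; g \<in> Hom M A B; h \<in> Hom M B C\<rbrakk> \<Longrightarrow> (f \<boxplus> g) \<Zcomp> h = f \<Zcomp> h \<boxplus> g \<Zcomp> h"

definition is_zero_object :: "('o, 'm, 'b) precat_scheme \<Rightarrow> 'o \<Rightarrow> bool"
  where "is_zero_object M Z \<longleftrightarrow> Z \<in> Obj M \<and>
    (\<forall>A \<in> Obj M. (\<exists>!f. f \<in> Hom M A Z) \<and> (\<exists>!f. f \<in> Hom M Z A))"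

definition is_direct_sum ::
    "('o, 'm, 'b) precat_scheme \<Rightarrow> 'o \<Rightarrow> 'o \<Rightarrow> 'o \<times> 'm \<times> 'm \<times> 'm \<times> 'm \<Rightarrow> bool"
  where "is_direct_sum M A B = (\<lambda>(S, i1, i2, p1, p2). S \<in> Obj M \<and>
    i1 \<in> Hom M A S \<and> i2 \<in> Hom M B S \<and> p1 \<in> Hom M S A \<and> p2 \<in> Hom M S B \<and>
    i1 \<Zcomp>\<^bsub>M\<^esub> p1 = Ident M A \<and> i2 \<Zcomp>\<^bsub>M\<^esub> p2 = Ident M B \<and>
    i1 \<Zcomp>\<^bsub>M\<^esub> p2 = Null M A B \<and> i2 \<Zcomp>\<^bsub>M\<^esub> p1 = Null M B A \<and>
    p1 \<Zcomp>\<^bsub>M\<^esub> i1 \<boxplus>\<^bsub>M\<^esub> p2 \<Zcomp>\<^bsub>M\<^esub> i2 = Ident M S)"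

locale additive_category = preadditive_category +
  assumes ex_zero_object: "\<exists>Z. is_zero_object M Z"
    and ex_direct_sum: "\<lbrakk>A \<in> Obj M; B \<in> Obj M\<rbrakk> \<Longrightarrow> \<exists>S. is_direct_sum M A B S"

text \<open>
  A fixed choice of direct sum for every pair of objects.  Direct sums are unique up to a
  unique isomorphism compatible with injections and projections, so nothing below depends on
  the choice.
\<close>

definition direct_sum :: "('o, 'm, 'b) precat_scheme \<Rightarrow> 'o \<Rightarrow> 'o \<Rightarrow> 'o \<times> 'm \<times> 'm \<times> 'm \<times> 'm"
  where "direct_sum M A B = (SOME S. is_direct_sum M A B S)"

definition DSum :: "('o, 'm, 'b) precat_scheme \<Rightarrow> 'o \<Rightarrow> 'o \<Rightarrow> 'o"
  where "DSum M A B = (case direct_sum M A B of (S, i1, i2, p1, p2) \<Rightarrow> S)"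

definition Inj1 :: "('o, 'm, 'b) precat_scheme \<Rightarrow> 'o \<Rightarrow> 'o \<Rightarrow> 'm"
  where "Inj1 M A B = (case direct_sum M A B of (S, i1, i2, p1, p2) \<Rightarrow> i1)"

definition Inj2 :: "('o, 'm, 'b) precat_scheme \<Rightarrow> 'o \<Rightarrow> 'o \<Rightarrow> 'm"
  where "Inj2 M A B = (case direct_sum M A B of (S, i1, i2, p1, p2) \<Rightarrow> i2)"

definition Proj1 :: "('o, 'm, 'b) precat_scheme \<Rightarrow> 'o \<Rightarrow> 'o \<Rightarrow> 'm"
  where "Proj1 M A B = (case direct_sum M A B of (S, i1, i2, p1, p2) \<Rightarrow> p1)"

definition Proj2 :: "('o, 'm, 'b) precat_scheme \<Rightarrow> 'o \<Rightarrow> 'o \<Rightarrow> 'm"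
  where "Proj2 M A B = (case direct_sum M A B of (S, i1, i2, p1, p2) \<Rightarrow> p2)"

text \<open>
  Matrices act on columns: \<open>col_mor\<close> is the morphism \<open>A \<rightarrow> B \<oplus> B'\<close> with entries \<open>f\<close>, \<open>g\<close>;
  \<open>row_mor\<close> is \<open>[f g] : A \<oplus> A' \<rightarrow> B\<close>; \<open>mat_mor\<close> is the matrix with rows \<open>[a b]\<close> and \<open>[c d]\<close>
  from \<open>A \<oplus> A'\<close> to \<open>B \<oplus> B'\<close>, so that \<open>b : A' \<rightarrow> B\<close> and \<open>c : A \<rightarrow> B'\<close>.
\<close>

definition col_mor :: "('o, 'm, 'b) precat_scheme \<Rightarrow> 'o \<Rightarrow> 'o \<Rightarrow> 'm \<Rightarrow> 'm \<Rightarrow> 'm"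
  where "col_mor M B B' f g = f \<Zcomp>\<^bsub>M\<^esub> Inj1 M B B' \<boxplus>\<^bsub>M\<^esub> g \<Zcomp>\<^bsub>M\<^esub> Inj2 M B B'"

definition row_mor :: "('o, 'm, 'b) precat_scheme \<Rightarrow> 'o \<Rightarrow> 'o \<Rightarrow> 'm \<Rightarrow> 'm \<Rightarrow> 'm"
  where "row_mor M A A' f g = Proj1 M A A' \<Zcomp>\<^bsub>M\<^esub> f \<boxplus>\<^bsub>M\<^esub> Proj2 M A A' \<Zcomp>\<^bsub>M\<^esub> g"

definition mat_mor ::
    "('o, 'm, 'b) precat_scheme \<Rightarrow> 'o \<Rightarrow> 'o \<Rightarrow> 'o \<Rightarrow> 'o \<Rightarrow> 'm \<Rightarrow> 'm \<Rightarrow> 'm \<Rightarrow> 'm \<Rightarrow> 'm"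
  where "mat_mor M A A' B B' a b c d = col_mor M B B' (row_mor M A A' a b) (row_mor M A A' c d)"


section \<open>Monomorphisms, epimorphisms, idempotents\<close>

definition is_mono :: "('o, 'm, 'b) precat_scheme \<Rightarrow> 'm \<Rightarrow> bool"
  where "is_mono M f \<longleftrightarrow> f \<in> Arr M \<and>
    (\<forall>C \<in> Obj M. \<forall>g \<in> Hom M C (Dom M f). \<forall>h \<in> Hom M C (Dom M f).
      g \<Zcomp>\<^bsub>M\<^esub> f = h \<Zcomp>\<^bsub>M\<^esub> f \<longrightarrow> g = h)"

definition is_epi :: "('o, 'm, 'b) precat_scheme \<Rightarrow> 'm \<Rightarrow> bool"
  where "is_epi M f \<longleftrightarrow> f \<in> Arr M \<and>
    (\<forall>C \<in> Obj M. \<forall>g \<in> Hom M (Cod M f) C. \<forall>h \<in> Hom M (Cod M f) C.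
      f \<Zcomp>\<^bsub>M\<^esub> g = f \<Zcomp>\<^bsub>M\<^esub> h \<longrightarrow> g = h)"

definition idempotent_complete :: "('o, 'm, 'b) precat_scheme \<Rightarrow> bool"
  where "idempotent_complete M \<longleftrightarrow>
    (\<forall>A \<in> Obj M. \<forall>e \<in> Hom M A A. e \<Zcomp>\<^bsub>M\<^esub> e = e \<longrightarrow>
      (\<exists>B \<in> Obj M. \<exists>r \<in> Hom M A B. \<exists>s \<in> Hom M B A.
        r \<Zcomp>\<^bsub>M\<^esub> s = e \<and> s \<Zcomp>\<^bsub>M\<^esub> r = Ident M B))"


section \<open>Complexes and n-exact sequences\<close>

text \<open>
  A sequence \<open>X 0 \<rightarrow> X 1 \<rightarrow> \<dots> \<rightarrow> X m\<close> is a pair of functions \<open>X\<close>, \<open>d\<close> on the naturals, with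
  \<open>d i : X i \<rightarrow> X (i + 1)\<close>.  Only \<open>X i\<close> for \<open>i \<le> m\<close> and \<open>d i\<close> for \<open>i < m\<close> are relevant.
\<close>

definition is_sequence ::
    "('o, 'm, 'b) precat_scheme \<Rightarrow> nat \<Rightarrow> (nat \<Rightarrow> 'o) \<Rightarrow> (nat \<Rightarrow> 'm) \<Rightarrow> bool"
  where "is_sequence M m X d \<longleftrightarrow>
    (\<forall>i \<le> m. X i \<in> Obj M) \<and> (\<forall>i < m. d i \<in> Hom M (X i) (X (i + 1)))"

definition is_complex ::
    "('o, 'm, 'b) precat_scheme \<Rightarrow> nat \<Rightarrow> (nat \<Rightarrow> 'o) \<Rightarrow> (nat \<Rightarrow> 'm) \<Rightarrow> bool"
  where "is_complex M m X d \<longleftrightarrow> is_sequence M m X d \<and>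
    (\<forall>i. i + 1 < m \<longrightarrow> d i \<Zcomp>\<^bsub>M\<^esub> d (i + 1) = Null M (X i) (X (i + 2)))"

definition is_complex_morphism ::
    "('o, 'm, 'b) precat_scheme \<Rightarrow> nat \<Rightarrow> (nat \<Rightarrow> 'o) \<Rightarrow> (nat \<Rightarrow> 'm) \<Rightarrow>
      (nat \<Rightarrow> 'o) \<Rightarrow> (nat \<Rightarrow> 'm) \<Rightarrow> (nat \<Rightarrow> 'm) \<Rightarrow> bool"
  where "is_complex_morphism M m X dX Y dY f \<longleftrightarrow>
    is_complex M m X dX \<and> is_complex M m Y dY \<and>
    (\<forall>i \<le> m. f i \<in> Hom M (X i) (Y i)) \<and>
    (\<forall>i < m. dX i \<Zcomp>\<^bsub>M\<^esub> f (i + 1) = f i \<Zcomp>\<^bsub>M\<^esub> dY i)"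

text \<open>
  \<open>is_n_cokernel M n X d\<close> says that \<open>(d 1, \<dots>, d n)\<close> is an \<open>n\<close>-cokernel of \<open>d 0\<close>.
  \<open>exact_seq\<close> lists an exact sequence from right to left: its lists start with the last group
  and the last map.
\<close>

definition is_n_cokernel ::
    "('o, 'm, 'b) precat_scheme \<Rightarrow> nat \<Rightarrow> (nat \<Rightarrow> 'o) \<Rightarrow> (nat \<Rightarrow> 'm) \<Rightarrow> bool"
  where "is_n_cokernel M n X d \<longleftrightarrow> is_sequence M (n + 1) X d \<and>
    (\<forall>Y \<in> Obj M. exact_seq
      (map (\<lambda>i. hom_group M (X i) Y) [0..<n + 2] @ [singleton_group (Null M (X (n + 1)) Y)],
       map (\<lambda>i h. d i \<Zcomp>\<^bsub>M\<^esub> h) [0..<n + 1] @ [\<lambda>h. h]))"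

text \<open>\<open>is_n_kernel M n X d\<close> says that \<open>(d 0, \<dots>, d (n - 1))\<close> is an \<open>n\<close>-kernel of \<open>d n\<close>.\<close>

definition is_n_kernel ::
    "('o, 'm, 'b) precat_scheme \<Rightarrow> nat \<Rightarrow> (nat \<Rightarrow> 'o) \<Rightarrow> (nat \<Rightarrow> 'm) \<Rightarrow> bool"
  where "is_n_kernel M n X d \<longleftrightarrow> is_sequence M (n + 1) X d \<and>
    (\<forall>Y \<in> Obj M. exact_seq
      (map (\<lambda>i. hom_group M Y (X i)) (rev [0..<n + 2]) @ [singleton_group (Null M Y (X 0))],
       map (\<lambda>i h. h \<Zcomp>\<^bsub>M\<^esub> d i) (rev [0..<n + 1]) @ [\<lambda>h. h]))"

definition is_n_exact ::
    "('o, 'm, 'b) precat_scheme \<Rightarrow> nat \<Rightarrow> (nat \<Rightarrow> 'o) \<Rightarrow> (nat \<Rightarrow> 'm) \<Rightarrow> bool"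
  where "is_n_exact M n X d \<longleftrightarrow>
    is_complex M (n + 1) X d \<and> is_n_kernel M n X d \<and> is_n_cokernel M n X d"

definition has_n_kernels :: "('o, 'm, 'b) precat_scheme \<Rightarrow> nat \<Rightarrow> bool"
  where "has_n_kernels M n \<longleftrightarrow>
    (\<forall>A \<in> Obj M. \<forall>B \<in> Obj M. \<forall>f \<in> Hom M A B.
      \<exists>X d. X n = A \<and> X (n + 1) = B \<and> d n = f \<and> is_n_kernel M n X d)"

definition has_n_cokernels :: "('o, 'm, 'b) precat_scheme \<Rightarrow> nat \<Rightarrow> bool"
  where "has_n_cokernels M n \<longleftrightarrow>
    (\<forall>A \<in> Obj M. \<forall>B \<in> Obj M. \<forall>f \<in> Hom M A B.
      \<exists>X d. X 0 = A \<and> X 1 = B \<and> d 0 = f \<and> is_n_cokernel M n X d)"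

locale n_abelian_category = additive_category +
  fixes n :: nat
  assumes A0: "idempotent_complete M"
    and A1: "has_n_kernels M n" "has_n_cokernels M n"
    and A2: "\<lbrakk>is_mono M (d 0); is_n_cokernel M n X d\<rbrakk> \<Longrightarrow> is_n_exact M n X d"
    and A2_op: "\<lbrakk>is_epi M (d n); is_n_kernel M n X d\<rbrakk> \<Longrightarrow> is_n_exact M n X d"


section \<open>Mapping cones and n-pushout diagrams\<close>

text \<open>
  The mapping cone of \<open>f : X \<rightarrow> Y\<close> sits in degrees \<open>-1, \<dots>, n\<close>; here its degrees are shifted up
  by one, so that index \<open>j\<close> carries \<open>X j \<oplus> Y (j - 1)\<close> for \<open>1 \<le> j \<le> n\<close> and \<open>cone_diff\<close> at \<open>j\<close>
  is the differential in degree \<open>j - 1\<close>.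
\<close>

definition cone_obj ::
    "('o, 'm, 'b) precat_scheme \<Rightarrow> nat \<Rightarrow> (nat \<Rightarrow> 'o) \<Rightarrow> (nat \<Rightarrow> 'o) \<Rightarrow> nat \<Rightarrow> 'o"
  where "cone_obj M n X Y j =
    (if j = 0 then X 0 else if j \<le> n then DSum M (X j) (Y (j - 1)) else Y n)"

definition cone_diff ::
    "('o, 'm, 'b) precat_scheme \<Rightarrow> nat \<Rightarrow> (nat \<Rightarrow> 'o) \<Rightarrow> (nat \<Rightarrow> 'm) \<Rightarrow>
      (nat \<Rightarrow> 'o) \<Rightarrow> (nat \<Rightarrow> 'm) \<Rightarrow> (nat \<Rightarrow> 'm) \<Rightarrow> nat \<Rightarrow> 'm"
  where "cone_diff M n X dX Y dY f j =
    (if j = 0 then col_mor M (X 1) (Y 0) (\<boxminus>\<^bsub>M\<^esub> dX 0) (f 0)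
     else if j < n then mat_mor M (X j) (Y (j - 1)) (X (j + 1)) (Y j)
       (\<boxminus>\<^bsub>M\<^esub> dX j) (Null M (Y (j - 1)) (X (j + 1)))
       (f j)           (dY (j - 1))
     else row_mor M (X n) (Y (n - 1)) (f n) (dY (n - 1)))"

definition is_n_pushout ::
    "('o, 'm, 'b) precat_scheme \<Rightarrow> nat \<Rightarrow> (nat \<Rightarrow> 'o) \<Rightarrow> (nat \<Rightarrow> 'm) \<Rightarrow> 'm \<Rightarrow>
      (nat \<Rightarrow> 'o) \<Rightarrow> (nat \<Rightarrow> 'm) \<Rightarrow> (nat \<Rightarrow> 'm) \<Rightarrow> bool"
  where "is_n_pushout M n X dX f0 Y dY f \<longleftrightarrow>
    is_complex_morphism M n X dX Y dY f \<and> f 0 = f0 \<and>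
    is_n_cokernel M n (cone_obj M n X Y) (cone_diff M n X dX Y dY f)"

end

theory Submission
  imports Defs
begin

text \<open>
  Call \<open>g\<close> a weak cokernel of \<open>f\<close> if \<open>f \<Zcomp> g = 0\<close> and every morphism killed by \<open>f\<close> factors through
  \<open>g\<close>, not necessarily uniquely.  Unwinding exactness of the Hom sequences, an \<open>n\<close>-cokernel of
  \<open>d 0\<close> is a sequence in which each \<open>d (i + 1)\<close> is a weak cokernel of \<open>d i\<close> and the last morphism
  is an epimorphism (\<open>is_n_cokernel_iff\<close>).

  Existence.  The complex \<open>Y\<close> is built one object at a time: \<open>Y (j + 1)\<close> is the target of a weak
  cokernel of the cone differential already available at \<open>j\<close>, and the two entries of that row
  matrix are \<open>F (j + 1)\<close> and \<open>dY j\<close>.  That the row vanishes on the cone differential is exactly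
  the commutativity of the next square together with \<open>dY (j - 1) \<Zcomp> dY j = 0\<close>
  (\<open>cone_diff_row_eq_Null_iff\<close>); and since the row is a component of the next cone differential,
  that differential is again a weak cokernel (\<open>cone_weak_cokernel\<close>).  Only the last step must
  produce a genuine cokernel, because the final morphism has to be an epimorphism.

  That this cokernel exists is the heart of the matter (\<open>weak_cokernels_last_cokernel\<close>).  Think of
  a sequence of weak cokernels \<open>X 0 \<rightarrow> \<dots> \<rightarrow> X n\<close> as the beginning of a projective resolution by
  representable functors; an \<open>n\<close>-cokernel of its first morphism is a resolution of the same functor
  that stops one step after \<open>X n\<close>.  As in Schanuel's lemma, the functor of
  morphisms on \<open>X n\<close> killed by \<open>d (n - 1)\<close> is then a direct summand of a representable one, hence
  representable itself because idempotents split; and a representing object is a cokernel.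
  Concretely the two resolutions are compared by chain maps and a homotopy
  (\<open>weak_cokernels_comparison\<close>), and the resulting idempotent is split
  (\<open>natural_weak_cokernel_splits\<close>).

  Monomorphisms.  If \<open>dX 0\<close> is a monomorphism, so is the first cone differential, whose first
  component is \<open>- dX 0\<close>.  In an \<open>n\<close>-abelian category the cone is therefore \<open>n\<close>-exact, and the
  first differential is a weak kernel of the second.  If \<open>g \<Zcomp> dY 0 = 0\<close>, the column with entries \<open>0\<close>
  and \<open>g\<close> is killed by the second differential, so it factors as \<open>k\<close> followed by the first;
  comparing first entries gives \<open>k = 0\<close>, whence \<open>g = 0\<close> (\<open>n_pushout_mono\<close>).
\<close>

section \<open>Exact sequences of groups\<close>

text \<open>
  Exactness is defined inductively along the two lists; the sequences of Hom groups have variable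
  length, and for them it is needed position by position.
\<close>

lemma exact_seq_iff_nth:
  assumes "fs \<noteq> []" and "length Gs = length fs + 1"
  shows "exact_seq (Gs, fs) \<longleftrightarrow>
    (\<forall>i < length fs. group_hom (Gs ! Suc i) (Gs ! i) (fs ! i)) \<and>
    (\<forall>i. Suc i < length fs \<longrightarrow>
      kernel (Gs ! Suc i) (Gs ! i) (fs ! i) = (fs ! Suc i) ` carrier (Gs ! Suc (Suc i)))"
    (is "_ \<longleftrightarrow> ?R Gs fs")
proof
  assume ex: "exact_seq (Gs, fs)"
  show "?R Gs fs"
    using exact_seq_imp_group_hom_arbitrary[OF ex] exact_seq_imp_exact_hom_arbitrary[OF ex]
    by auto
next
  assume "?R Gs fs"
  with assms show "exact_seq (Gs, fs)"
  proof (induction fs arbitrary: Gs)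
    case Nil
    then show ?case by simp
  next
    case (Cons h fs)
    then obtain H G Ls where Gs: "Gs = H # G # Ls"
      by (auto simp: length_Suc_conv)
    have hom: "group_hom (Gs ! Suc i) (Gs ! i) ((h # fs) ! i)" if "i < Suc (length fs)" for i
      using Cons.prems(3) that by simp
    have gh: "group_hom G H h"
      using hom[of 0] by (simp add: Gs)
    show ?case
    proof (cases fs)
      case Nil
      with Cons.prems(2) Gs gh show ?thesis
        by (simp add: exact_seq.unity)
    next
      case (Cons g q)
      then obtain K l where Ls: "Ls = K # l"
        using Cons.prems(2) Gs by (cases Ls) auto
      have ex: "exact_seq (G # K # l, g # q)"
      proof (rule Cons.IH[of "G # K # l", unfolded Cons])
        show "length (G # K # l) = length (g # q) + 1"
          using Cons.prems(2) Gs Ls Cons by simp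
        have "group_hom ((G # K # l) ! Suc i) ((G # K # l) ! i) ((g # q) ! i)"
          if "i < length (g # q)" for i
          using hom[of "Suc i"] that by (simp add: Gs Ls Cons)
        moreover have "kernel ((G # K # l) ! Suc i) ((G # K # l) ! i) ((g # q) ! i) =
            ((g # q) ! Suc i) ` carrier ((G # K # l) ! Suc (Suc i))"
          if "Suc i < length (g # q)" for i
          using conjunct2[OF Cons.prems(3), rule_format, of "Suc i"] that by (simp add: Gs Ls Cons)
        ultimately show "?R (G # K # l) (g # q)" by blast
      qed simp
      have ker: "kernel G H h = g ` carrier K"
        using conjunct2[OF Cons.prems(3), rule_format, of 0] by (simp add: Gs Ls Cons)
      show ?thesis
        unfolding Gs Ls Cons
        by (intro exact_seq.extension[OF ex _ _ ker])
          (use gh in \<open>auto simp: group_hom_def group_hom_axioms_def\<close>)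
    qed
  qed
qed

section \<open>Preadditive categories and n-cokernels\<close>

text \<open>
  For \<open>f : A \<rightarrow> B\<close> and \<open>g : B \<rightarrow> C\<close> this says that \<open>Hom(C, W) \<rightarrow> Hom(B, W) \<rightarrow> Hom(A, W)\<close> is exact
  for every \<open>W\<close>, which is one of the exactness conditions of an \<open>n\<close>-cokernel.
\<close>

definition is_weak_cokernel :: "('o, 'm, 'b) precat_scheme \<Rightarrow> 'm \<Rightarrow> 'm \<Rightarrow> bool"
  where "is_weak_cokernel M f g \<longleftrightarrow> f \<in> Arr M \<and> g \<in> Arr M \<and> Dom M g = Cod M f \<and>
    f \<Zcomp>\<^bsub>M\<^esub> g = Null M (Dom M f) (Cod M g) \<and>
    (\<forall>W \<in> Obj M. \<forall>w \<in> Hom M (Cod M f) W. f \<Zcomp>\<^bsub>M\<^esub> w = Null M (Dom M f) W \<longrightarrow>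
      (\<exists>k \<in> Hom M (Cod M g) W. w = g \<Zcomp>\<^bsub>M\<^esub> k))"

context category
begin

lemma HomD:
  assumes "f \<in> Hom M A B"
  shows "A \<in> Obj M" "B \<in> Obj M" "f \<in> Arr M" "Dom M f = A" "Cod M f = B"
  using assms Dom_closed Cod_closed by (auto simp: Hom_def)

end

context preadditive_category
begin

lemma Plus_closed: "\<lbrakk>f \<in> Hom M A B; g \<in> Hom M A B\<rbrakk> \<Longrightarrow> f \<boxplus> g \<in> Hom M A B"
  using comm_groupE(1)[OF hom_comm_group[OF HomD(1,2)]] by (simp add: hom_group_def)

lemma Null_closed: "\<lbrakk>A \<in> Obj M; B \<in> Obj M\<rbrakk> \<Longrightarrow> Null M A B \<in> Hom M A B"
  using comm_groupE(2)[OF hom_comm_group] by (simp add: hom_group_def)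

lemma Plus_assoc:
  "\<lbrakk>f \<in> Hom M A B; g \<in> Hom M A B; h \<in> Hom M A B\<rbrakk> \<Longrightarrow> (f \<boxplus> g) \<boxplus> h = f \<boxplus> (g \<boxplus> h)"
  using comm_groupE(3)[OF hom_comm_group[OF HomD(1,2)]] by (simp add: hom_group_def)

lemma Plus_commute: "\<lbrakk>f \<in> Hom M A B; g \<in> Hom M A B\<rbrakk> \<Longrightarrow> f \<boxplus> g = g \<boxplus> f"
  using comm_groupE(4)[OF hom_comm_group[OF HomD(1,2)]] by (simp add: hom_group_def)

lemma Null_Plus: "f \<in> Hom M A B \<Longrightarrow> Null M A B \<boxplus> f = f"
  using comm_groupE(5)[OF hom_comm_group[OF HomD(1,2)]] by (simp add: hom_group_def)

lemma Plus_Null: "f \<in> Hom M A B \<Longrightarrow> f \<boxplus> Null M A B = f"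
  using Null_Plus Plus_commute Null_closed[OF HomD(1,2)] by metis

lemma Neg_closed: "f \<in> Hom M A B \<Longrightarrow> \<boxminus> f \<in> Hom M A B"
  using group.inv_closed[OF comm_group.axioms(2)[OF hom_comm_group[OF HomD(1,2)]]]
  by (simp add: Neg_def hom_group_def HomD(4,5))

lemma Neg_Plus: "f \<in> Hom M A B \<Longrightarrow> \<boxminus> f \<boxplus> f = Null M A B"
  using group.l_inv[OF comm_group.axioms(2)[OF hom_comm_group[OF HomD(1,2)]]]
  by (simp add: Neg_def hom_group_def HomD(4,5))

lemma Plus_Neg: "f \<in> Hom M A B \<Longrightarrow> f \<boxplus> \<boxminus> f = Null M A B"
  using Neg_Plus Plus_commute Neg_closed by metis

lemma Plus_left_cancel:
  assumes "f \<in> Hom M A B" "g \<in> Hom M A B" "h \<in> Hom M A B" "f \<boxplus> g = f \<boxplus> h"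
  shows "g = h"
proof -
  have "\<boxminus> f \<boxplus> (f \<boxplus> g) = \<boxminus> f \<boxplus> (f \<boxplus> h)"
    using assms(4) by simp
  then have "(\<boxminus> f \<boxplus> f) \<boxplus> g = (\<boxminus> f \<boxplus> f) \<boxplus> h"
    using assms(1-3) by (simp add: Plus_assoc[OF Neg_closed])
  then show ?thesis
    using assms(1-3) by (simp add: Neg_Plus Null_Plus)
qed

lemma Comp_Null:
  assumes "f \<in> Hom M A B" "C \<in> Obj M"
  shows "f \<Zcomp> Null M B C = Null M A C"
proof (rule Plus_left_cancel)
  have N: "Null M B C \<in> Hom M B C"
    using Null_closed HomD[OF assms(1)] assms(2) by blast
  then show fN: "f \<Zcomp> Null M B C \<in> Hom M A C" "f \<Zcomp> Null M B C \<in> Hom M A C"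
    using Comp_closed assms(1) by blast+
  show "Null M A C \<in> Hom M A C"
    using Null_closed HomD[OF assms(1)] assms(2) by blast
  have "f \<Zcomp> Null M B C \<boxplus> f \<Zcomp> Null M B C = f \<Zcomp> (Null M B C \<boxplus> Null M B C)"
    using Comp_distrib_left[OF assms(1) N N] by simp
  then show "f \<Zcomp> Null M B C \<boxplus> f \<Zcomp> Null M B C = f \<Zcomp> Null M B C \<boxplus> Null M A C"
    by (simp add: Plus_Null[OF N] Plus_Null[OF fN(1)])
qed

lemma Null_Comp:
  assumes "f \<in> Hom M B C" "A \<in> Obj M"
  shows "Null M A B \<Zcomp> f = Null M A C"
proof (rule Plus_left_cancel)
  have N: "Null M A B \<in> Hom M A B"
    using Null_closed HomD[OF assms(1)] assms(2) by blast
  then show fN: "Null M A B \<Zcomp> f \<in> Hom M A C" "Null M A B \<Zcomp> f \<in> Hom M A C"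
    using Comp_closed assms(1) by blast+
  show "Null M A C \<in> Hom M A C"
    using Null_closed HomD[OF assms(1)] assms(2) by blast
  have "Null M A B \<Zcomp> f \<boxplus> Null M A B \<Zcomp> f = (Null M A B \<boxplus> Null M A B) \<Zcomp> f"
    using Comp_distrib_right[OF N N assms(1)] by simp
  then show "Null M A B \<Zcomp> f \<boxplus> Null M A B \<Zcomp> f = Null M A B \<Zcomp> f \<boxplus> Null M A C"
    by (simp add: Plus_Null[OF N] Plus_Null[OF fN(1)])
qed

lemma Neg_eq_iff:
  assumes "f \<in> Hom M A B" "g \<in> Hom M A B"
  shows "\<boxminus> f \<boxplus> g = Null M A B \<longleftrightarrow> f = g"
  using Plus_left_cancel[OF Neg_closed[OF assms(1)] assms] Neg_Plus[OF assms(1)] by metis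

lemma Neg_Null:
  assumes "A \<in> Obj M" "B \<in> Obj M"
  shows "\<boxminus> (Null M A B) = Null M A B"
  using Neg_Plus[OF Null_closed[OF assms]] Plus_Null[OF Neg_closed[OF Null_closed[OF assms]]]
  by simp

lemma Neg_eq_Null_iff:
  assumes "f \<in> Hom M A B"
  shows "\<boxminus> f = Null M A B \<longleftrightarrow> f = Null M A B"
  using Neg_eq_iff[OF assms Null_closed[OF HomD(1,2)[OF assms]]]
    Plus_Null[OF Neg_closed[OF assms]] by simp

lemma Comp_Neg:
  assumes f: "f \<in> Hom M A B" and g: "g \<in> Hom M B C"
  shows "f \<Zcomp> \<boxminus> g = \<boxminus> (f \<Zcomp> g)"
proof (rule Plus_left_cancel)
  show "f \<Zcomp> g \<in> Hom M A C" "f \<Zcomp> \<boxminus> g \<in> Hom M A C" "\<boxminus> (f \<Zcomp> g) \<in> Hom M A C"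
    using f g Comp_closed Neg_closed by blast+
  show "f \<Zcomp> g \<boxplus> f \<Zcomp> \<boxminus> g = f \<Zcomp> g \<boxplus> \<boxminus> (f \<Zcomp> g)"
    using Comp_distrib_left[OF f g Neg_closed[OF g]] Comp_Null[OF f HomD(2)[OF g]]
      Plus_Neg[OF g] Plus_Neg[OF Comp_closed[OF f g]] by simp
qed

lemma Neg_Comp:
  assumes f: "f \<in> Hom M A B" and g: "g \<in> Hom M B C"
  shows "\<boxminus> f \<Zcomp> g = \<boxminus> (f \<Zcomp> g)"
proof (rule Plus_left_cancel)
  show "f \<Zcomp> g \<in> Hom M A C" "\<boxminus> f \<Zcomp> g \<in> Hom M A C" "\<boxminus> (f \<Zcomp> g) \<in> Hom M A C"
    using f g Comp_closed Neg_closed by blast+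
  show "f \<Zcomp> g \<boxplus> \<boxminus> f \<Zcomp> g = f \<Zcomp> g \<boxplus> \<boxminus> (f \<Zcomp> g)"
    using Comp_distrib_right[OF f Neg_closed[OF f] g] Null_Comp[OF g HomD(1)[OF f]]
      Plus_Neg[OF f] Plus_Neg[OF Comp_closed[OF f g]] by simp
qed

lemma is_mono_iff:
  assumes f: "f \<in> Hom M A B"
  shows "is_mono M f \<longleftrightarrow> (\<forall>W. \<forall>g \<in> Hom M W A. g \<Zcomp> f = Null M W B \<longrightarrow> g = Null M W A)"
    (is "_ \<longleftrightarrow> ?R")
proof
  assume mono: "is_mono M f"
  have "g = Null M W A" if g: "g \<in> Hom M W A" and g0: "g \<Zcomp> f = Null M W B" for W g
  proof -
    have W: "W \<in> Obj M" and A: "A \<in> Obj M"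
      using HomD(1,2)[OF g] by blast+
    have "g \<Zcomp> f = Null M W A \<Zcomp> f"
      using g0 Null_Comp[OF f W] by simp
    then show ?thesis
      using mono g Null_closed[OF W A] W HomD(4)[OF f] by (simp add: is_mono_def)
  qed
  then show ?R by blast
next
  assume R: ?R
  have "g = h" if g: "g \<in> Hom M W A" and h: "h \<in> Hom M W A" and eq: "g \<Zcomp> f = h \<Zcomp> f" for W g h
  proof -
    have "(\<boxminus> g \<boxplus> h) \<Zcomp> f = Null M W B"
      using Comp_distrib_right[OF Neg_closed[OF g] h f] Neg_Comp[OF g f] eq
        Neg_Plus[OF Comp_closed[OF h f]] by simp
    then have "\<boxminus> g \<boxplus> h = Null M W A"
      using R Plus_closed[OF Neg_closed[OF g] h] by blast
    then show ?thesis
      using Neg_eq_iff[OF g h] by simp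
  qed
  then show "is_mono M f"
    using HomD[OF f] by (simp add: is_mono_def)
qed

text \<open>
  The morphism \<open>t\<close> is the difference \<open>b - a\<close>.  Stating its two properties avoids computing with
  negatives when homotopies are built.
\<close>

lemma complement_annihilated:
  assumes d: "d \<in> Hom M A B" and a: "a \<in> Hom M B C" and b: "b \<in> Hom M B C"
    and eq: "d \<Zcomp> a = d \<Zcomp> b"
  obtains t where "t \<in> Hom M B C" "a \<boxplus> t = b" "d \<Zcomp> t = Null M A C"
proof
  let ?t = "\<boxminus> a \<boxplus> b"
  show t: "?t \<in> Hom M B C"
    using a b Plus_closed Neg_closed by blast
  show "a \<boxplus> ?t = b"
    using Plus_assoc[OF a Neg_closed[OF a] b] by (simp add: Plus_Neg[OF a] Null_Plus[OF b])
  show "d \<Zcomp> ?t = Null M A C"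
    by (simp add: Comp_distrib_left[OF d Neg_closed[OF a] b] Comp_Neg[OF d a] eq
        Neg_Plus[OF Comp_closed[OF d b]])
qed

lemma is_weak_cokernel_iff:
  assumes "f \<in> Hom M A B" "g \<in> Hom M B C"
  shows "is_weak_cokernel M f g \<longleftrightarrow> f \<Zcomp> g = Null M A C \<and>
    (\<forall>W. \<forall>w \<in> Hom M B W. f \<Zcomp> w = Null M A W \<longrightarrow> (\<exists>k \<in> Hom M C W. w = g \<Zcomp> k))"
  using HomD[OF assms(1)] HomD[OF assms(2)] HomD(2) 
  by (auto simp: is_weak_cokernel_def)

lemma hom_group_simps [simp]:
  "carrier (hom_group M A B) = Hom M A B"
  "monoid.mult (hom_group M A B) = Plus M"
  "one (hom_group M A B) = Null M A B"
  by (simp_all add: hom_group_def)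

lemma group_hom_precomp:
  assumes f: "f \<in> Hom M A B" and W: "W \<in> Obj M"
  shows "group_hom (hom_group M B W) (hom_group M A W) (\<lambda>h. f \<Zcomp> h)"
proof -
  have "group (hom_group M B W)" "group (hom_group M A W)"
    using hom_comm_group HomD(1,2)[OF f] W comm_group.axioms(2) by blast+
  moreover have "(\<lambda>h. f \<Zcomp> h) \<in> hom (hom_group M B W) (hom_group M A W)"
    using f by (auto intro!: homI Comp_closed Comp_distrib_left)
  ultimately show ?thesis
    by (simp add: group_hom_def group_hom_axioms_def)
qed

lemma epi_iff_trivial_kernel:
  assumes f: "f \<in> Hom M A B"
  shows "is_epi M f \<longleftrightarrow>
    (\<forall>W \<in> Obj M. kernel (hom_group M B W) (hom_group M A W) (\<lambda>h. f \<Zcomp> h) = {Null M B W})"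
proof -
  have "is_epi M f \<longleftrightarrow> (\<forall>W \<in> Obj M. inj_on (\<lambda>h. f \<Zcomp> h) (Hom M B W))"
    using HomD[OF f] by (auto simp: is_epi_def inj_on_def)
  then show ?thesis
    using group_hom.inj_iff_trivial_ker[OF group_hom_precomp[OF f]] by simp
qed

lemma kernel_precomp_eq_image_iff:
  assumes f: "f \<in> Hom M A B" and g: "g \<in> Hom M B C"
  shows "is_weak_cokernel M f g \<longleftrightarrow>
    (\<forall>W \<in> Obj M. kernel (hom_group M B W) (hom_group M A W) (\<lambda>h. f \<Zcomp> h) =
      (\<lambda>h. g \<Zcomp> h) ` Hom M C W)" (is "_ \<longleftrightarrow> ?R")
proof
  assume wc: "is_weak_cokernel M f g"
  then have 0: "f \<Zcomp> g = Null M A C"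
    using is_weak_cokernel_iff[OF f g] by blast
  show ?R
  proof (intro ballI equalityI subsetI)
    fix W w assume "W \<in> Obj M" "w \<in> kernel (hom_group M B W) (hom_group M A W) (\<lambda>h. f \<Zcomp> h)"
    then show "w \<in> (\<lambda>h. g \<Zcomp> h) ` Hom M C W"
      using wc is_weak_cokernel_iff[OF f g] by (auto simp: kernel_def)
  next
    fix W w assume "w \<in> (\<lambda>h. g \<Zcomp> h) ` Hom M C W"
    then obtain h where h: "h \<in> Hom M C W" "w = g \<Zcomp> h" by blast
    then have "f \<Zcomp> w = Null M A W"
      using Comp_assoc[OF f g h(1)] 0 Null_Comp HomD(1)[OF f] by metis
    then show "w \<in> kernel (hom_group M B W) (hom_group M A W) (\<lambda>h. f \<Zcomp> h)"
      using h g Comp_closed by (auto simp: kernel_def)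
  qed
next
  assume R: ?R
  have "g = g \<Zcomp> Ident M C"
    using Ident_right[OF g] by simp
  then have "g \<in> kernel (hom_group M B C) (hom_group M A C) (\<lambda>h. f \<Zcomp> h)"
    using R HomD(2)[OF g] Ident_closed by blast
  then have "f \<Zcomp> g = Null M A C"
    by (simp add: kernel_def)
  moreover have "\<exists>k \<in> Hom M C W. w = g \<Zcomp> k" if "w \<in> Hom M B W" "f \<Zcomp> w = Null M A W" for W w
  proof -
    have "w \<in> kernel (hom_group M B W) (hom_group M A W) (\<lambda>h. f \<Zcomp> h)"
      using that by (simp add: kernel_def)
    then show ?thesis
      using R HomD(2)[OF that(1)] by blast
  qed
  ultimately show "is_weak_cokernel M f g"
    using is_weak_cokernel_iff[OF f g] by blast
qed

lemma group_hom_inclusion_Null: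
  assumes "A \<in> Obj M" "B \<in> Obj M"
  shows "group_hom (singleton_group (Null M A B)) (hom_group M A B) (\<lambda>h. h)"
proof -
  interpret comm_group "hom_group M A B"
    using hom_comm_group[OF assms] .
  show ?thesis
    using id_hom_singleton by (auto simp: group_hom_def group_hom_axioms_def id_def)
qed

text \<open>
  The exact sequence of an \<open>n\<close>-cokernel has a zero group at one end: exactness there is
  injectivity of composition with \<open>d n\<close>, and at the other places it is the weak cokernel property.
\<close>

lemma is_n_cokernel_iff:
  assumes seq: "is_sequence M (n + 1) X d"
  shows "is_n_cokernel M n X d \<longleftrightarrow>
    (\<forall>i < n. is_weak_cokernel M (d i) (d (i + 1))) \<and> is_epi M (d n)"
proof -
  have obj: "X i \<in> Obj M" if "i \<le> n + 1" for i
    using seq that by (simp add: is_sequence_def)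
  have d: "d i \<in> Hom M (X i) (X (i + 1))" if "i \<le> n" for i
    using seq that by (simp add: is_sequence_def)
  define Gs where
    "Gs W = map (\<lambda>i. hom_group M (X i) W) [0..<n + 2] @ [singleton_group (Null M (X (n + 1)) W)]" for W
  define fs where "fs = map (\<lambda>i h. d i \<Zcomp> h) [0..<n + 1] @ [\<lambda>h. h]"
  have len: "length (Gs W) = n + 3" "length fs = n + 2" for W
    by (simp_all add: Gs_def fs_def)
  have G: "Gs W ! i = hom_group M (X i) W" if "i < n + 2" for W i
    using that by (simp add: Gs_def nth_append del: upt_Suc)
  have G_last: "Gs W ! (n + 2) = singleton_group (Null M (X (n + 1)) W)" for W
    by (simp add: Gs_def nth_append del: upt_Suc)
  have F: "fs ! i = (\<lambda>h. d i \<Zcomp> h)" if "i < n + 1" for i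
    using that by (simp add: fs_def nth_append del: upt_Suc)
  have F_last: "fs ! (n + 1) = (\<lambda>h. h)"
    by (simp add: fs_def nth_append del: upt_Suc)
  have hom: "group_hom (Gs W ! Suc i) (Gs W ! i) (fs ! i)"
    if "W \<in> Obj M" "i < n + 2" for W i
  proof (cases "i = n + 1")
    case True
    then show ?thesis
      using group_hom_inclusion_Null[OF obj that(1), of "n + 1"] G[of i W] G_last[of W] F_last
      by simp
  next
    case False
    then show ?thesis
      using group_hom_precomp[OF d that(1), of i] that(2) G[of i W] G[of "Suc i" W] F[of i]
      by simp
  qed
  have exact: "exact_seq (Gs W, fs) \<longleftrightarrow>
      (\<forall>i < n. kernel (hom_group M (X (i + 1)) W) (hom_group M (X i) W) (\<lambda>h. d i \<Zcomp> h) =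
        (\<lambda>h. d (i + 1) \<Zcomp> h) ` Hom M (X (i + 2)) W) \<and>
      kernel (hom_group M (X (n + 1)) W) (hom_group M (X n) W) (\<lambda>h. d n \<Zcomp> h) =
        {Null M (X (n + 1)) W}" (is "_ \<longleftrightarrow> ?R W")
    if W: "W \<in> Obj M" for W
  proof -
    have "exact_seq (Gs W, fs) \<longleftrightarrow>
      (\<forall>i < n + 1. kernel (Gs W ! Suc i) (Gs W ! i) (fs ! i) =
        (fs ! Suc i) ` carrier (Gs W ! Suc (Suc i)))"
      using hom[OF W] len by (subst exact_seq_iff_nth) auto
    also have "\<dots> \<longleftrightarrow> (\<forall>i < n. kernel (Gs W ! Suc i) (Gs W ! i) (fs ! i) =
        (fs ! Suc i) ` carrier (Gs W ! Suc (Suc i))) \<and>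
      kernel (Gs W ! (n + 1)) (Gs W ! n) (fs ! n) = (fs ! (n + 1)) ` carrier (Gs W ! (n + 2))"
      by (auto simp: less_Suc_eq)
    also have "\<dots> \<longleftrightarrow> ?R W"
      unfolding G_last F_last by (simp add: G F)
    finally show ?thesis .
  qed
  have "is_n_cokernel M n X d \<longleftrightarrow> (\<forall>W \<in> Obj M. exact_seq (Gs W, fs))"
    using seq unfolding is_n_cokernel_def Gs_def fs_def by blast
  also have "\<dots> \<longleftrightarrow> (\<forall>W \<in> Obj M. ?R W)"
    by (intro ball_cong refl exact)
  also have "\<dots> \<longleftrightarrow> (\<forall>i < n. is_weak_cokernel M (d i) (d (i + 1))) \<and> is_epi M (d n)"
  proof -
    have "is_weak_cokernel M (d i) (d (i + 1)) \<longleftrightarrow>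
      (\<forall>W \<in> Obj M. kernel (hom_group M (X (i + 1)) W) (hom_group M (X i) W) (\<lambda>h. d i \<Zcomp> h) =
        (\<lambda>h. d (i + 1) \<Zcomp> h) ` Hom M (X (i + 2)) W)" if "i < n" for i
      using kernel_precomp_eq_image_iff[OF d d, of i] that by simp
    moreover have "is_epi M (d n) \<longleftrightarrow>
      (\<forall>W \<in> Obj M. kernel (hom_group M (X (n + 1)) W) (hom_group M (X n) W) (\<lambda>h. d n \<Zcomp> h) =
        {Null M (X (n + 1)) W})"
      using epi_iff_trivial_kernel[OF d[of n]] by simp
    ultimately show ?thesis by auto
  qed
  finally show ?thesis .
qed

text \<open>
  The dual use of exactness: in the list of Hom groups, which runs from \<open>X (n + 1)\<close> down to \<open>X 0\<close>,
  the group of morphisms into \<open>X 1\<close> stands at position \<open>n\<close>.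
\<close>

lemma n_kernel_first_lift:
  assumes ker: "is_n_kernel M n X d" and n: "n \<ge> 1"
    and g: "g \<in> Hom M W (X 1)" "g \<Zcomp> d 1 = Null M W (X 2)"
  obtains h where "h \<in> Hom M W (X 0)" "h \<Zcomp> d 0 = g"
proof -
  define Gs where
    "Gs = map (\<lambda>i. hom_group M W (X i)) (rev [0..<n + 2]) @ [singleton_group (Null M W (X 0))]"
  define fs where "fs = map (\<lambda>i h. h \<Zcomp> d i) (rev [0..<n + 1]) @ [\<lambda>h. h]"
  have len: "length fs = n + 2"
    by (simp add: fs_def)
  have G: "Gs ! i = hom_group M W (X (n + 1 - i))" if "i < n + 2" for i
    using that by (simp add: Gs_def nth_append rev_nth del: upt_Suc)
  have F: "fs ! i = (\<lambda>h. h \<Zcomp> d (n - i))" if "i < n + 1" for i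
    using that by (simp add: fs_def nth_append rev_nth del: upt_Suc)
  have "exact_seq (Gs, fs)"
    using ker HomD(1)[OF g(1)] unfolding is_n_kernel_def Gs_def fs_def by blast
  from exact_seq_imp_exact_hom_arbitrary[OF this, of "n - 1"]
  have "(fs ! n) ` carrier (Gs ! Suc n) = kernel (Gs ! n) (Gs ! (n - 1)) (fs ! (n - 1))"
    using n len by simp
  moreover have "Gs ! Suc n = hom_group M W (X 0)" "Gs ! n = hom_group M W (X 1)"
      "Gs ! (n - 1) = hom_group M W (X 2)"
    using n by (auto simp: G)
  moreover have "fs ! n = (\<lambda>h. h \<Zcomp> d 0)" "fs ! (n - 1) = (\<lambda>h. h \<Zcomp> d 1)"
    using n by (auto simp: F)
  ultimately have "(\<lambda>h. h \<Zcomp> d 0) ` Hom M W (X 0) =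
      kernel (hom_group M W (X 1)) (hom_group M W (X 2)) (\<lambda>h. h \<Zcomp> d 1)"
    by simp
  moreover have "g \<in> kernel (hom_group M W (X 1)) (hom_group M W (X 2)) (\<lambda>h. h \<Zcomp> d 1)"
    using g by (simp add: kernel_def)
  ultimately have "g \<in> (\<lambda>h. h \<Zcomp> d 0) ` Hom M W (X 0)"
    by simp
  then show thesis
    by (elim imageE) (auto intro: that)
qed

end

section \<open>Matrices of morphisms\<close>

context additive_category
begin

lemma is_direct_sum_DSum:
  assumes "A \<in> Obj M" "B \<in> Obj M"
  shows "is_direct_sum M A B (DSum M A B, Inj1 M A B, Inj2 M A B, Proj1 M A B, Proj2 M A B)"
proof -
  have "is_direct_sum M A B (direct_sum M A B)"
    unfolding direct_sum_def using someI_ex[OF ex_direct_sum[OF assms]] .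
  then show ?thesis
    by (cases "direct_sum M A B") (simp add: DSum_def Inj1_def Inj2_def Proj1_def Proj2_def)
qed

lemma DSum_props:
  assumes "A \<in> Obj M" "B \<in> Obj M"
  shows DSum_closed: "DSum M A B \<in> Obj M"
    and Inj1_closed: "Inj1 M A B \<in> Hom M A (DSum M A B)"
    and Inj2_closed: "Inj2 M A B \<in> Hom M B (DSum M A B)"
    and Proj1_closed: "Proj1 M A B \<in> Hom M (DSum M A B) A"
    and Proj2_closed: "Proj2 M A B \<in> Hom M (DSum M A B) B"
    and Inj1_Proj1: "Inj1 M A B \<Zcomp> Proj1 M A B = Ident M A"
    and Inj2_Proj2: "Inj2 M A B \<Zcomp> Proj2 M A B = Ident M B"
    and Inj1_Proj2: "Inj1 M A B \<Zcomp> Proj2 M A B = Null M A B"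
    and Inj2_Proj1: "Inj2 M A B \<Zcomp> Proj1 M A B = Null M B A"
    and Proj_Inj_sum:
      "Proj1 M A B \<Zcomp> Inj1 M A B \<boxplus> Proj2 M A B \<Zcomp> Inj2 M A B = Ident M (DSum M A B)"
  using is_direct_sum_DSum[OF assms] by (simp_all add: is_direct_sum_def)

lemma row_closed:
  assumes f: "f \<in> Hom M A W" and g: "g \<in> Hom M B W"
  shows "row_mor M A B f g \<in> Hom M (DSum M A B) W"
  unfolding row_mor_def
  by (intro Plus_closed Comp_closed[OF Proj1_closed f] Comp_closed[OF Proj2_closed g]
      HomD(1)[OF f] HomD(1)[OF g])

lemma col_closed:
  assumes f: "f \<in> Hom M W A" and g: "g \<in> Hom M W B"
  shows "col_mor M A B f g \<in> Hom M W (DSum M A B)"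
  unfolding col_mor_def
  by (intro Plus_closed Comp_closed[OF f Inj1_closed] Comp_closed[OF g Inj2_closed]
      HomD(2)[OF f] HomD(2)[OF g])

lemma row_Comp:
  assumes f: "f \<in> Hom M A W" and g: "g \<in> Hom M B W" and k: "k \<in> Hom M W V"
  shows "row_mor M A B f g \<Zcomp> k = row_mor M A B (f \<Zcomp> k) (g \<Zcomp> k)"
proof -
  note P1 = Proj1_closed[OF HomD(1)[OF f] HomD(1)[OF g]]
  note P2 = Proj2_closed[OF HomD(1)[OF f] HomD(1)[OF g]]
  show ?thesis
    unfolding row_mor_def
    by (simp add: Comp_distrib_right[OF Comp_closed[OF P1 f] Comp_closed[OF P2 g] k]
        Comp_assoc[OF P1 f k] Comp_assoc[OF P2 g k])
qed

lemma Comp_col: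
  assumes f: "f \<in> Hom M W A" and g: "g \<in> Hom M W B" and k: "k \<in> Hom M V W"
  shows "k \<Zcomp> col_mor M A B f g = col_mor M A B (k \<Zcomp> f) (k \<Zcomp> g)"
proof -
  note I1 = Inj1_closed[OF HomD(2)[OF f] HomD(2)[OF g]]
  note I2 = Inj2_closed[OF HomD(2)[OF f] HomD(2)[OF g]]
  show ?thesis
    unfolding col_mor_def
    by (simp add: Comp_distrib_left[OF k Comp_closed[OF f I1] Comp_closed[OF g I2]]
        Comp_assoc[OF k f I1] Comp_assoc[OF k g I2])
qed

lemma Inj_row:
  assumes f: "f \<in> Hom M A W" and g: "g \<in> Hom M B W"
  shows Inj1_row: "Inj1 M A B \<Zcomp> row_mor M A B f g = f"
    and Inj2_row: "Inj2 M A B \<Zcomp> row_mor M A B f g = g"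
proof -
  have A: "A \<in> Obj M" and B: "B \<in> Obj M"
    using HomD(1) f g by blast+
  note I1 = Inj1_closed[OF A B] and I2 = Inj2_closed[OF A B]
    and P1 = Proj1_closed[OF A B] and P2 = Proj2_closed[OF A B]
  note P1f = Comp_closed[OF P1 f] and P2g = Comp_closed[OF P2 g]
  have "Inj1 M A B \<Zcomp> row_mor M A B f g = Ident M A \<Zcomp> f \<boxplus> Null M A B \<Zcomp> g"
    unfolding row_mor_def Comp_distrib_left[OF I1 P1f P2g]
    by (simp add: Comp_assoc[OF I1 P1 f, symmetric] Comp_assoc[OF I1 P2 g, symmetric]
        Inj1_Proj1[OF A B] Inj1_Proj2[OF A B])
  then show "Inj1 M A B \<Zcomp> row_mor M A B f g = f"
    by (simp add: Ident_left[OF f] Null_Comp[OF g A] Plus_Null[OF f])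
  have "Inj2 M A B \<Zcomp> row_mor M A B f g = Null M B A \<Zcomp> f \<boxplus> Ident M B \<Zcomp> g"
    unfolding row_mor_def Comp_distrib_left[OF I2 P1f P2g]
    by (simp add: Comp_assoc[OF I2 P1 f, symmetric] Comp_assoc[OF I2 P2 g, symmetric]
        Inj2_Proj1[OF A B] Inj2_Proj2[OF A B])
  then show "Inj2 M A B \<Zcomp> row_mor M A B f g = g"
    by (simp add: Ident_left[OF g] Null_Comp[OF f B] Null_Plus[OF g])
qed

lemma col_row:
  assumes f: "f \<in> Hom M W A" and g: "g \<in> Hom M W B"
    and a: "a \<in> Hom M A V" and b: "b \<in> Hom M B V"
  shows "col_mor M A B f g \<Zcomp> row_mor M A B a b = f \<Zcomp> a \<boxplus> g \<Zcomp> b"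
proof -
  note I1 = Inj1_closed[OF HomD(2)[OF f] HomD(2)[OF g]]
  note I2 = Inj2_closed[OF HomD(2)[OF f] HomD(2)[OF g]]
  note r = row_closed[OF a b]
  show ?thesis
    unfolding col_mor_def Comp_distrib_right[OF Comp_closed[OF f I1] Comp_closed[OF g I2] r]
    by (simp add: Comp_assoc[OF f I1 r] Comp_assoc[OF g I2 r] Inj1_row[OF a b] Inj2_row[OF a b])
qed

lemma row_Inj_Comp:
  assumes A: "A \<in> Obj M" and B: "B \<in> Obj M" and h: "h \<in> Hom M (DSum M A B) W"
  shows "row_mor M A B (Inj1 M A B \<Zcomp> h) (Inj2 M A B \<Zcomp> h) = h"
proof -
  note I1 = Inj1_closed[OF A B] and I2 = Inj2_closed[OF A B]
    and P1 = Proj1_closed[OF A B] and P2 = Proj2_closed[OF A B]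
  have "row_mor M A B (Inj1 M A B \<Zcomp> h) (Inj2 M A B \<Zcomp> h) =
      (Proj1 M A B \<Zcomp> Inj1 M A B \<boxplus> Proj2 M A B \<Zcomp> Inj2 M A B) \<Zcomp> h"
    unfolding row_mor_def
    by (simp add: Comp_distrib_right[OF Comp_closed[OF P1 I1] Comp_closed[OF P2 I2] h]
        Comp_assoc[OF P1 I1 h] Comp_assoc[OF P2 I2 h])
  then show ?thesis
    by (simp add: Proj_Inj_sum[OF A B] Ident_left[OF h])
qed

lemma row_Null:
  assumes "A \<in> Obj M" "B \<in> Obj M" "W \<in> Obj M"
  shows "row_mor M A B (Null M A W) (Null M B W) = Null M (DSum M A B) W"
  unfolding row_mor_def
  using assms by (simp add: Comp_Null[OF Proj1_closed] Comp_Null[OF Proj2_closed]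
      Plus_Null[OF Null_closed] DSum_closed)

lemma row_eq_Null_iff:
  assumes f: "f \<in> Hom M A W" and g: "g \<in> Hom M B W"
  shows "row_mor M A B f g = Null M (DSum M A B) W \<longleftrightarrow> f = Null M A W \<and> g = Null M B W"
proof -
  have obj: "A \<in> Obj M" "B \<in> Obj M" "W \<in> Obj M"
    using HomD f g by blast+
  show ?thesis
  proof
    assume "row_mor M A B f g = Null M (DSum M A B) W"
    then show "f = Null M A W \<and> g = Null M B W"
      using Inj_row[OF f g] Comp_Null[OF Inj1_closed[OF obj(1,2)] obj(3)]
        Comp_Null[OF Inj2_closed[OF obj(1,2)] obj(3)] by simp
  qed (simp add: row_Null[OF obj])
qed

lemma col_Proj:
  assumes f: "f \<in> Hom M W A" and g: "g \<in> Hom M W B"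
  shows col_Proj1: "col_mor M A B f g \<Zcomp> Proj1 M A B = f"
    and col_Proj2: "col_mor M A B f g \<Zcomp> Proj2 M A B = g"
proof -
  have A: "A \<in> Obj M" and B: "B \<in> Obj M"
    using HomD(2) f g by blast+
  note P1 = Proj1_closed[OF A B] and P2 = Proj2_closed[OF A B]
  note IA = Ident_closed[OF A] and IB = Ident_closed[OF B]
  have "row_mor M A B (Ident M A) (Null M B A) = Proj1 M A B"
    using row_Inj_Comp[OF A B P1] by (simp add: Inj1_Proj1[OF A B] Inj2_Proj1[OF A B])
  then show "col_mor M A B f g \<Zcomp> Proj1 M A B = f"
    using col_row[OF f g IA Null_closed[OF B A]]
    by (simp add: Ident_right[OF f] Comp_Null[OF g A] Plus_Null[OF f])
  have "row_mor M A B (Null M A B) (Ident M B) = Proj2 M A B"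
    using row_Inj_Comp[OF A B P2] by (simp add: Inj1_Proj2[OF A B] Inj2_Proj2[OF A B])
  then show "col_mor M A B f g \<Zcomp> Proj2 M A B = g"
    using col_row[OF f g Null_closed[OF A B] IB]
    by (simp add: Ident_right[OF g] Comp_Null[OF f B] Null_Plus[OF g])
qed

lemma col_Null:
  assumes "A \<in> Obj M" "B \<in> Obj M" "W \<in> Obj M"
  shows "col_mor M A B (Null M W A) (Null M W B) = Null M W (DSum M A B)"
  unfolding col_mor_def
  using assms by (simp add: Null_Comp[OF Inj1_closed] Null_Comp[OF Inj2_closed]
      Plus_Null[OF Null_closed] DSum_closed)

lemma mat_closed:
  assumes "a \<in> Hom M A B" "b \<in> Hom M A' B" "c \<in> Hom M A B'" "d \<in> Hom M A' B'"
  shows "mat_mor M A A' B B' a b c d \<in> Hom M (DSum M A A') (DSum M B B')"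
  unfolding mat_mor_def using assms by (intro col_closed row_closed)

text \<open>
  A morphism out of a direct sum vanishes iff its restrictions to both summands do, and these
  restrictions are the entries of the matrix product.
\<close>

lemma mat_row_eq_Null_iff:
  assumes a: "a \<in> Hom M A B" and b: "b \<in> Hom M A' B"
    and c: "c \<in> Hom M A B'" and d: "d \<in> Hom M A' B'"
    and x: "x \<in> Hom M B W" and y: "y \<in> Hom M B' W"
  shows "mat_mor M A A' B B' a b c d \<Zcomp> row_mor M B B' x y = Null M (DSum M A A') W \<longleftrightarrow>
    a \<Zcomp> x \<boxplus> c \<Zcomp> y = Null M A W \<and> b \<Zcomp> x \<boxplus> d \<Zcomp> y = Null M A' W" (is "?m = _ \<longleftrightarrow> _")
proof -
  have A: "A \<in> Obj M" and A': "A' \<in> Obj M"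
    using HomD(1) a b by blast+
  note I1 = Inj1_closed[OF A A'] and I2 = Inj2_closed[OF A A']
  note ab = row_closed[OF a b] and cd = row_closed[OF c d]
  have m: "?m = row_mor M A A' a b \<Zcomp> x \<boxplus> row_mor M A A' c d \<Zcomp> y"
    unfolding mat_mor_def by (rule col_row[OF ab cd x y])
  have m_Hom: "?m \<in> Hom M (DSum M A A') W"
    unfolding m using ab cd x y by (intro Plus_closed Comp_closed)
  have 1: "Inj1 M A A' \<Zcomp> ?m = a \<Zcomp> x \<boxplus> c \<Zcomp> y"
    unfolding m Comp_distrib_left[OF I1 Comp_closed[OF ab x] Comp_closed[OF cd y]]
    by (simp add: Comp_assoc[OF I1 ab x, symmetric] Comp_assoc[OF I1 cd y, symmetric]
        Inj1_row[OF a b] Inj1_row[OF c d])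
  have 2: "Inj2 M A A' \<Zcomp> ?m = b \<Zcomp> x \<boxplus> d \<Zcomp> y"
    unfolding m Comp_distrib_left[OF I2 Comp_closed[OF ab x] Comp_closed[OF cd y]]
    by (simp add: Comp_assoc[OF I2 ab x, symmetric] Comp_assoc[OF I2 cd y, symmetric]
        Inj2_row[OF a b] Inj2_row[OF c d])
  show ?thesis
    using row_eq_Null_iff[OF Comp_closed[OF I1 m_Hom] Comp_closed[OF I2 m_Hom]]
      row_Inj_Comp[OF A A' m_Hom] unfolding 1 2 by simp
qed

end

section \<open>The last cokernel of a sequence of weak cokernels\<close>

context preadditive_category
begin

text \<open>
  By Yoneda, a retract of a representable functor is representable if idempotents split.  The
  functor here sends \<open>W\<close> to the morphisms \<open>w : B \<rightarrow> W\<close> with \<open>d \<Zcomp> w = 0\<close>; composition with \<open>c\<close> maps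
  \<open>Hom(E, W)\<close> onto it and \<open>\<sigma>\<close> is a natural section.  The corresponding idempotent endomorphism of
  \<open>E\<close> is \<open>\<sigma> c\<close>, and \<open>c\<close> followed by the projection to its image is a cokernel of \<open>d\<close>.
\<close>

lemma natural_weak_cokernel_splits:
  assumes split: "idempotent_complete M"
    and d: "d \<in> Hom M A B" and c: "c \<in> Hom M B E" "d \<Zcomp> c = Null M A E"
    and sec: "\<And>W w. \<lbrakk>w \<in> Hom M B W; d \<Zcomp> w = Null M A W\<rbrakk> \<Longrightarrow> \<sigma> w \<in> Hom M E W \<and> c \<Zcomp> \<sigma> w = w"
    and natural: "\<And>W w V g. \<lbrakk>w \<in> Hom M B W; d \<Zcomp> w = Null M A W; g \<in> Hom M W V\<rbrakk>
      \<Longrightarrow> \<sigma> (w \<Zcomp> g) = \<sigma> w \<Zcomp> g"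
  obtains C q where "q \<in> Hom M B C" "is_weak_cokernel M d q" "is_epi M q"
proof -
  have e: "\<sigma> c \<in> Hom M E E" "c \<Zcomp> \<sigma> c = c"
    using sec[OF c] by auto
  have "\<sigma> c \<Zcomp> \<sigma> c = \<sigma> c"
    using natural[OF c e(1)] e(2) by simp
  then obtain C r s where r: "r \<in> Hom M E C" and s: "s \<in> Hom M C E"
    and rs: "r \<Zcomp> s = \<sigma> c" and sr: "s \<Zcomp> r = Ident M C"
    using split e(1) HomD(1)[OF e(1)] unfolding idempotent_complete_def by blast
  define q where "q = c \<Zcomp> r"
  have q: "q \<in> Hom M B C"
    unfolding q_def using Comp_closed[OF c(1) r] .
  show thesis
  proof
    show "q \<in> Hom M B C" by fact
    show "is_weak_cokernel M d q"
      unfolding is_weak_cokernel_iff[OF d q]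
    proof (intro conjI allI ballI impI)
      show "d \<Zcomp> q = Null M A C"
        unfolding q_def Comp_assoc[OF d c(1) r, symmetric] c(2) using Null_Comp[OF r HomD(1)[OF d]] .
      fix W w assume w: "w \<in> Hom M B W" "d \<Zcomp> w = Null M A W"
      then have sw: "\<sigma> w \<in> Hom M E W" "c \<Zcomp> \<sigma> w = w"
        using sec by blast+
      have "\<sigma> w = (r \<Zcomp> s) \<Zcomp> \<sigma> w"
        using natural[OF c sw(1)] by (simp add: rs sw(2))
      then have "w = q \<Zcomp> (s \<Zcomp> \<sigma> w)"
        using sw(2) Comp_assoc[OF r s sw(1)] Comp_assoc[OF c(1) r Comp_closed[OF s sw(1)]]
        by (simp add: q_def)
      then show "\<exists>k \<in> Hom M C W. w = q \<Zcomp> k"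
        using Comp_closed[OF s sw(1)] by blast
    qed
    \<comment> \<open>A morphism \<open>x\<close> can be recovered from \<open>q \<Zcomp> x\<close> as \<open>s \<Zcomp> \<sigma> (q \<Zcomp> x)\<close>.\<close>
    have "k = l" if "k \<in> Hom M C W" "l \<in> Hom M C W" "q \<Zcomp> k = q \<Zcomp> l" for W k l
    proof -
      have "x = s \<Zcomp> \<sigma> (q \<Zcomp> x)" if x: "x \<in> Hom M C W" for x
      proof -
        have rx: "r \<Zcomp> x \<in> Hom M E W"
          using Comp_closed[OF r x] .
        have "\<sigma> (q \<Zcomp> x) = \<sigma> (c \<Zcomp> (r \<Zcomp> x))"
          by (simp add: q_def Comp_assoc[OF c(1) r x])
        also have "\<dots> = r \<Zcomp> x"
          using natural[OF c rx] Comp_assoc[OF r s rx] Comp_assoc[OF s r x]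
          by (simp add: rs[symmetric] sr Ident_left[OF x])
        finally show ?thesis
          using Comp_assoc[OF s r x] by (simp add: sr Ident_left[OF x])
      qed
      then show ?thesis
        using that by metis
    qed
    then show "is_epi M q"
      using HomD[OF q] by (auto simp: is_epi_def)
  qed
qed

lemma weak_cokernelD:
  assumes "is_weak_cokernel M f g" "f \<in> Hom M A B" "g \<in> Hom M B C"
  shows "f \<Zcomp> g = Null M A C"
    and "\<lbrakk>w \<in> Hom M B W; f \<Zcomp> w = Null M A W\<rbrakk> \<Longrightarrow> \<exists>k \<in> Hom M C W. w = g \<Zcomp> k"
  using assms(1) unfolding is_weak_cokernel_iff[OF assms(2,3)] by blast+

text \<open>
  Two sequences of weak cokernels that start with the same morphism admit chain maps in both
  directions, and the composite from \<open>X\<close> back to \<open>X\<close> is homotopic to the identity. Here \<open>u\<close>, \<open>u'\<close>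
  and \<open>v\<close>, \<open>v'\<close> are neighbouring components of the chain maps in the two directions and \<open>s\<close> is a
  component of the homotopy. The defect \<open>t = 1 - u \<Zcomp> v - s \<Zcomp> d k\<close> vanishes after composition with
  \<open>d k\<close>, so it factors through \<open>d (k + 1)\<close>, which provides the next component of the homotopy. As
  each step uses only the components of the previous one, a statement about a single place
  suffices for the induction.
\<close>

lemma weak_cokernels_comparison:
  assumes X: "is_sequence M m X d" "\<And>i. i + 1 < m \<Longrightarrow> is_weak_cokernel M (d i) (d (i + 1))"
    and Y: "is_sequence M m Y e" "\<And>i. i + 1 < m \<Longrightarrow> is_weak_cokernel M (e i) (e (i + 1))"
    and start: "Y 0 = X 0" "Y 1 = X 1" "e 0 = d 0"
    and k: "k < m"
  shows "\<exists>u \<in> Hom M (X (k + 1)) (Y (k + 1)). \<exists>v \<in> Hom M (Y (k + 1)) (X (k + 1)).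
    \<exists>u' \<in> Hom M (X k) (Y k). \<exists>v' \<in> Hom M (Y k) (X k).
    \<exists>s \<in> Hom M (X (k + 1)) (X k). \<exists>t \<in> Hom M (X (k + 1)) (X (k + 1)).
      d k \<Zcomp> u = u' \<Zcomp> e k \<and> e k \<Zcomp> v = v' \<Zcomp> d k \<and>
      d k \<Zcomp> t = Null M (X k) (X (k + 1)) \<and>
      (u \<Zcomp> v \<boxplus> s \<Zcomp> d k) \<boxplus> t = Ident M (X (k + 1))"
  using k
proof (induction k)
  case 0
  have d0: "d 0 \<in> Hom M (X 0) (X 1)"
    using X(1) 0 by (simp add: is_sequence_def)
  have o: "X 0 \<in> Obj M" "X 1 \<in> Obj M"
    using HomD[OF d0] by blast+
  let ?i0 = "Ident M (X 0)" and ?i1 = "Ident M (X 1)"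
    and ?s = "Null M (X 1) (X 0)" and ?t = "Null M (X 1) (X 1)"
  have i: "?i0 \<in> Hom M (X 0) (X 0)" "?i1 \<in> Hom M (X 1) (X 1)"
    using o Ident_closed by blast+
  have n: "?s \<in> Hom M (X 1) (X 0)" "?t \<in> Hom M (X 1) (X 1)"
    using o Null_closed by blast+
  have "d 0 \<Zcomp> ?i1 = ?i0 \<Zcomp> d 0" "d 0 \<Zcomp> ?t = Null M (X 0) (X 1)"
    using Ident_left[OF d0] Ident_right[OF d0] Comp_Null[OF d0 o(2)] by simp_all
  moreover have "(?i1 \<Zcomp> ?i1 \<boxplus> ?s \<Zcomp> d 0) \<boxplus> ?t = ?i1"
    using Ident_left[OF i(2)] Null_Comp[OF d0 o(2)] Plus_Null[OF i(2)] by simp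
  ultimately show ?case
    using i n start by (simp only: add_0) blast
next
  case (Suc k)
  then have km: "k + 1 < m" by simp
  have d: "d i \<in> Hom M (X i) (X (i + 1))" and e: "e i \<in> Hom M (Y i) (Y (i + 1))"
    if "i < m" for i
    using X(1) Y(1) that by (auto simp: is_sequence_def)
  let ?A = "X k" and ?B = "X (k + 1)" and ?C = "X (k + 2)"
    and ?A' = "Y k" and ?B' = "Y (k + 1)" and ?C' = "Y (k + 2)"
  have dk: "d k \<in> Hom M ?A ?B" "d (k + 1) \<in> Hom M ?B ?C"
    and ek: "e k \<in> Hom M ?A' ?B'" "e (k + 1) \<in> Hom M ?B' ?C'"
    using d[of k] d[of "k + 1"] e[of k] e[of "k + 1"] km by simp_all
  note wd = weak_cokernelD[OF X(2)[OF km] dk] and we = weak_cokernelD[OF Y(2)[OF km] ek]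
  obtain u v u' v' s t where
    u: "u \<in> Hom M ?B ?B'" and v: "v \<in> Hom M ?B' ?B" and
    u': "u' \<in> Hom M ?A ?A'" and v': "v' \<in> Hom M ?A' ?A" and
    s: "s \<in> Hom M ?B ?A" and t: "t \<in> Hom M ?B ?B" and
    du: "d k \<Zcomp> u = u' \<Zcomp> e k" and ev: "e k \<Zcomp> v = v' \<Zcomp> d k" and
    dt: "d k \<Zcomp> t = Null M ?A ?B" and
    id: "(u \<Zcomp> v \<boxplus> s \<Zcomp> d k) \<boxplus> t = Ident M ?B"
    using Suc.IH km by auto
  note uv = Comp_closed[OF u v] and sd = Comp_closed[OF s dk(1)]
  have "d k \<Zcomp> (u \<Zcomp> e (k + 1)) = Null M ?A ?C'"
    using Comp_assoc[OF dk(1) u ek(2)] Comp_assoc[OF u' ek] Comp_Null[OF u' HomD(2)[OF ek(2)]]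
      du we(1) by simp
  then obtain u1 where u1: "u1 \<in> Hom M ?C ?C'" and du1: "u \<Zcomp> e (k + 1) = d (k + 1) \<Zcomp> u1"
    using wd(2)[OF Comp_closed[OF u ek(2)]] by blast
  have "e k \<Zcomp> (v \<Zcomp> d (k + 1)) = Null M ?A' ?C"
    using Comp_assoc[OF ek(1) v dk(2)] Comp_assoc[OF v' dk] Comp_Null[OF v' HomD(2)[OF dk(2)]]
      ev wd(1) by simp
  then obtain v1 where v1: "v1 \<in> Hom M ?C' ?C" and ev1: "v \<Zcomp> d (k + 1) = e (k + 1) \<Zcomp> v1"
    using we(2)[OF Comp_closed[OF v dk(2)]] by blast
  obtain s1 where s1: "s1 \<in> Hom M ?C ?B" and ds1: "t = d (k + 1) \<Zcomp> s1"
    using wd(2)[OF t dt] by blast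
  note uv1 = Comp_closed[OF u1 v1] and sd1 = Comp_closed[OF s1 dk(2)]
  have IC: "Ident M ?C \<in> Hom M ?C ?C"
    using Ident_closed HomD(2)[OF dk(2)] by blast
  \<comment> \<open>The next defect is again annihilated: expand the identity and use the new factorisations.\<close>
  have "d (k + 1) = ((u \<Zcomp> v \<boxplus> s \<Zcomp> d k) \<boxplus> t) \<Zcomp> d (k + 1)"
    using Ident_left[OF dk(2)] id by simp
  also have "\<dots> = (u \<Zcomp> v) \<Zcomp> d (k + 1) \<boxplus> (s \<Zcomp> d k) \<Zcomp> d (k + 1) \<boxplus> t \<Zcomp> d (k + 1)"
    by (simp only: Comp_distrib_right[OF Plus_closed[OF uv sd] t dk(2)]
        Comp_distrib_right[OF uv sd dk(2)])
  also have "(u \<Zcomp> v) \<Zcomp> d (k + 1) = d (k + 1) \<Zcomp> (u1 \<Zcomp> v1)"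
    using Comp_assoc[OF u v dk(2)] Comp_assoc[OF u ek(2) v1] Comp_assoc[OF dk(2) u1 v1]
    by (simp only: ev1 du1)
  also have "(s \<Zcomp> d k) \<Zcomp> d (k + 1) = Null M ?B ?C"
    using Comp_assoc[OF s dk] Comp_Null[OF s HomD(2)[OF dk(2)]] by (simp only: wd(1))
  also have "t \<Zcomp> d (k + 1) = d (k + 1) \<Zcomp> (s1 \<Zcomp> d (k + 1))"
    using Comp_assoc[OF dk(2) s1 dk(2)] by (simp only: ds1)
  finally have "d (k + 1) \<Zcomp> (u1 \<Zcomp> v1 \<boxplus> s1 \<Zcomp> d (k + 1)) = d (k + 1) \<Zcomp> Ident M ?C"
    by (simp only: Comp_distrib_left[OF dk(2) uv1 sd1] Plus_Null[OF Comp_closed[OF dk(2) uv1]]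
        Ident_right[OF dk(2)])
  then obtain t1 where t1: "t1 \<in> Hom M ?C ?C" "(u1 \<Zcomp> v1 \<boxplus> s1 \<Zcomp> d (k + 1)) \<boxplus> t1 = Ident M ?C"
      "d (k + 1) \<Zcomp> t1 = Null M ?B ?C"
    using complement_annihilated[OF dk(2) Plus_closed[OF uv1 sd1] IC] by blast
  have "Suc k = k + 1" "Suc k + 1 = k + 2" by simp_all
  then show ?case
    using u1 v1 u v s1 t1 du1 ev1 by metis
qed

end

context additive_category
begin

text \<open>
  With \<open>u\<close>, \<open>v\<close>, \<open>s\<close>, \<open>t\<close> from the comparison with an \<open>n\<close>-cokernel \<open>(Y, e)\<close> of \<open>d 0\<close>, a morphism \<open>w\<close>
  on \<open>X n\<close> killed by \<open>d (n - 1)\<close> satisfies \<open>w = u \<Zcomp> v \<Zcomp> w + t \<Zcomp> w\<close>.  Moreover \<open>v \<Zcomp> w\<close> is killed by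
  \<open>e (n - 1)\<close>, so \<open>v \<Zcomp> w = e n \<Zcomp> \<alpha> w\<close> for a unique \<open>\<alpha> w\<close>, as \<open>e n\<close> is an epimorphism.  Hence \<open>w\<close>
  factors through the column with entries \<open>u \<Zcomp> e n\<close> and \<open>t\<close> by means of the row \<open>[\<alpha> w  w]\<close>, and this
  factorisation is natural in \<open>w\<close> because \<open>\<alpha> w\<close> is unique.
\<close>

lemma weak_cokernels_last_cokernel:
  assumes split: "idempotent_complete M" and coker: "has_n_cokernels M n" and n: "n \<ge> 1"
    and X: "is_sequence M n X d" "\<And>i. i + 1 < n \<Longrightarrow> is_weak_cokernel M (d i) (d (i + 1))"
  obtains C q where "q \<in> Hom M (X n) C" "is_weak_cokernel M (d (n - 1)) q" "is_epi M q"
proof -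
  obtain k where k: "n = k + 1"
    using n by (metis add.commute le_Suc_ex)
  have d0: "d 0 \<in> Hom M (X 0) (X 1)" and dk: "d k \<in> Hom M (X k) (X (k + 1))"
    using X(1) by (simp_all add: is_sequence_def k)
  obtain Y e where start: "Y 0 = X 0" "Y 1 = X 1" "e 0 = d 0" and Y: "is_n_cokernel M n Y e"
    using coker d0 HomD(1,2)[OF d0] unfolding has_n_cokernels_def by blast
  have Y_seq: "is_sequence M (n + 1) Y e"
    using Y by (simp add: is_n_cokernel_def)
  have Y_wc: "is_weak_cokernel M (e i) (e (i + 1))" if "i < n" for i
    using Y is_n_cokernel_iff[OF Y_seq] that by blast
  have e_epi: "is_epi M (e n)"
    using Y is_n_cokernel_iff[OF Y_seq] by blast
  have ek: "e k \<in> Hom M (Y k) (Y (k + 1))" "e (k + 1) \<in> Hom M (Y (k + 1)) (Y (k + 2))"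
    using Y_seq by (auto simp: is_sequence_def k)
  note we = weak_cokernelD[OF Y_wc[of k, unfolded k, OF less_add_one] ek]
  have Y': "is_sequence M n Y e" "\<And>i. i + 1 < n \<Longrightarrow> is_weak_cokernel M (e i) (e (i + 1))"
    using Y_seq Y_wc by (simp_all add: is_sequence_def)
  from weak_cokernels_comparison[OF X Y' start, where k = k]
  obtain u v u' v' s t where
    u: "u \<in> Hom M (X (k + 1)) (Y (k + 1))" and v: "v \<in> Hom M (Y (k + 1)) (X (k + 1))" and
    u': "u' \<in> Hom M (X k) (Y k)" and v': "v' \<in> Hom M (Y k) (X k)" and
    s: "s \<in> Hom M (X (k + 1)) (X k)" and t: "t \<in> Hom M (X (k + 1)) (X (k + 1))" and
    du: "d k \<Zcomp> u = u' \<Zcomp> e k" and ev: "e k \<Zcomp> v = v' \<Zcomp> d k" and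
    dt: "d k \<Zcomp> t = Null M (X k) (X (k + 1))" and
    id: "(u \<Zcomp> v \<boxplus> s \<Zcomp> d k) \<boxplus> t = Ident M (X (k + 1))"
    using k by auto
  let ?B = "X (k + 1)" and ?N = "Y (k + 2)"
  let ?E = "DSum M ?N ?B"
  note ue = Comp_closed[OF u ek(2)]
  define c where "c = col_mor M ?N ?B (u \<Zcomp> e (k + 1)) t"
  have c: "c \<in> Hom M ?B ?E"
    unfolding c_def by (rule col_closed[OF ue t])
  have "d k \<Zcomp> (u \<Zcomp> e (k + 1)) = Null M (X k) ?N"
    using Comp_assoc[OF dk u ek(2)] Comp_assoc[OF u' ek] Comp_Null[OF u' HomD(2)[OF ek(2)]]
      du we(1) by simp
  then have dc: "d k \<Zcomp> c = Null M (X k) ?E"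
    unfolding c_def Comp_col[OF ue t dk] dt
    using col_Null[OF HomD(2)[OF ek(2)] HomD(2)[OF dk] HomD(1)[OF dk]] by simp
  have ex: "\<exists>a. a \<in> Hom M ?N W \<and> e (k + 1) \<Zcomp> a = v \<Zcomp> w"
    if w: "w \<in> Hom M ?B W" "d k \<Zcomp> w = Null M (X k) W" for W w
  proof -
    have "e k \<Zcomp> (v \<Zcomp> w) = Null M (Y k) W"
      using Comp_assoc[OF ek(1) v w(1)] Comp_assoc[OF v' dk w(1)] Comp_Null[OF v' HomD(2)[OF w(1)]]
      by (simp add: ev w(2))
    then show ?thesis
      using we(2)[OF Comp_closed[OF v w(1)]] by metis
  qed
  have uniq: "a = b" if "a \<in> Hom M ?N W" "b \<in> Hom M ?N W" "e (k + 1) \<Zcomp> a = e (k + 1) \<Zcomp> b" for W a b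
    using e_epi HomD[OF ek(2)] HomD(2)[OF that(1)] that by (simp add: is_epi_def k)
  \<comment> \<open>\<open>Cod M w\<close> recovers the target, so \<open>\<alpha>\<close> depends on \<open>w\<close> alone.\<close>
  define \<alpha> where "\<alpha> w = (SOME a. a \<in> Hom M ?N (Cod M w) \<and> e (k + 1) \<Zcomp> a = v \<Zcomp> w)" for w
  have \<alpha>: "\<alpha> w \<in> Hom M ?N W" "e (k + 1) \<Zcomp> \<alpha> w = v \<Zcomp> w"
    if w: "w \<in> Hom M ?B W" "d k \<Zcomp> w = Null M (X k) W" for W w
    using someI_ex[OF ex[OF w]] HomD(5)[OF w(1)] by (auto simp: \<alpha>_def)
  define \<sigma> where "\<sigma> w = row_mor M ?N ?B (\<alpha> w) w" for w
  show thesis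
  proof (rule natural_weak_cokernel_splits[OF split dk c dc])
    fix W w assume w: "w \<in> Hom M ?B W" "d k \<Zcomp> w = Null M (X k) W"
    note a = \<alpha>[OF w]
    have "c \<Zcomp> \<sigma> w = (u \<Zcomp> e (k + 1)) \<Zcomp> \<alpha> w \<boxplus> t \<Zcomp> w"
      unfolding c_def \<sigma>_def by (rule col_row[OF ue t a(1) w(1)])
    also have "(u \<Zcomp> e (k + 1)) \<Zcomp> \<alpha> w = (u \<Zcomp> v) \<Zcomp> w"
      using Comp_assoc[OF u ek(2) a(1)] Comp_assoc[OF u v w(1)] a(2) by simp
    also have "(u \<Zcomp> v) \<Zcomp> w = (u \<Zcomp> v) \<Zcomp> w \<boxplus> (s \<Zcomp> d k) \<Zcomp> w"
      using Comp_assoc[OF s dk w(1)] Comp_Null[OF s HomD(2)[OF w(1)]]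
        Plus_Null[OF Comp_closed[OF Comp_closed[OF u v] w(1)]] by (simp add: w(2))
    also have "((u \<Zcomp> v) \<Zcomp> w \<boxplus> (s \<Zcomp> d k) \<Zcomp> w) \<boxplus> t \<Zcomp> w = ((u \<Zcomp> v \<boxplus> s \<Zcomp> d k) \<boxplus> t) \<Zcomp> w"
      using Comp_closed[OF u v] Comp_closed[OF s dk] t w(1)
      by (simp add: Comp_distrib_right[OF Plus_closed] Comp_distrib_right)
    also have "\<dots> = w"
      unfolding id by (rule Ident_left[OF w(1)])
    finally show "\<sigma> w \<in> Hom M ?E W \<and> c \<Zcomp> \<sigma> w = w"
      using row_closed[OF a(1) w(1)] by (simp add: \<sigma>_def)
    fix V g assume g: "g \<in> Hom M W V"
    have wg: "w \<Zcomp> g \<in> Hom M ?B V" "d k \<Zcomp> (w \<Zcomp> g) = Null M (X k) V"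
      using Comp_closed[OF w(1) g] Comp_assoc[OF dk w(1) g] Null_Comp[OF g HomD(1)[OF dk]]
      by (simp_all add: w(2))
    have "\<alpha> (w \<Zcomp> g) = \<alpha> w \<Zcomp> g"
    proof (rule uniq[OF \<alpha>(1)[OF wg] Comp_closed[OF a(1) g]])
      show "e (k + 1) \<Zcomp> \<alpha> (w \<Zcomp> g) = e (k + 1) \<Zcomp> (\<alpha> w \<Zcomp> g)"
        using \<alpha>(2)[OF wg] Comp_assoc[OF ek(2) a(1) g] Comp_assoc[OF v w(1) g] a(2) by simp
    qed
    then show "\<sigma> (w \<Zcomp> g) = \<sigma> w \<Zcomp> g"
      unfolding \<sigma>_def row_Comp[OF a(1) w(1) g] by simp
  qed (use that in \<open>simp add: k\<close>)
qed

end

section \<open>Mapping cones and n-pushouts\<close>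

text \<open>
  The stage of the construction at which \<open>Y\<close> is known up to degree \<open>m\<close>.  The cone differentials at
  the indices \<open>j \<le> m\<close> depend only on these data when \<open>m < n\<close>; the row with entries \<open>f (j + 1)\<close> and
  \<open>dY j\<close> is the lower row of the next differential, or all of it if \<open>j + 1 = n\<close>.
\<close>

definition is_partial_n_pushout ::
    "('o, 'm, 'b) precat_scheme \<Rightarrow> nat \<Rightarrow> nat \<Rightarrow> (nat \<Rightarrow> 'o) \<Rightarrow> (nat \<Rightarrow> 'm) \<Rightarrow> 'm \<Rightarrow>
      (nat \<Rightarrow> 'o) \<Rightarrow> (nat \<Rightarrow> 'm) \<Rightarrow> (nat \<Rightarrow> 'm) \<Rightarrow> bool"
  where "is_partial_n_pushout M n m X dX f0 Y dY f \<longleftrightarrow>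
    is_complex_morphism M m X dX Y dY f \<and> f 0 = f0 \<and>
    (\<forall>j < m. is_weak_cokernel M (cone_diff M n X dX Y dY f j)
      (row_mor M (X (j + 1)) (Y j) (f (j + 1)) (dY j)))"

context preadditive_category
begin

lemma weak_cokernel_first:
  assumes coker: "has_n_cokernels M n" and n: "n \<ge> 1" and f: "f \<in> Hom M A B"
  obtains C g where "g \<in> Hom M B C" "is_weak_cokernel M f g"
proof -
  obtain X d where X: "X 0 = A" "X 1 = B" "d 0 = f" "is_n_cokernel M n X d"
    using coker f HomD(1,2)[OF f] unfolding has_n_cokernels_def by blast
  have seq: "is_sequence M (n + 1) X d"
    using X(4) by (simp add: is_n_cokernel_def)
  have "is_weak_cokernel M (d 0) (d (0 + 1))"
    using X(4) is_n_cokernel_iff[OF seq] n by simp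
  moreover have "d 1 \<in> Hom M (X 1) (X 2)"
    using seq n by (auto simp: is_sequence_def numeral_2_eq_2)
  ultimately show thesis
    using X(1-3) by (intro that[of "d 1" "X 2"]) simp_all
qed

end

context additive_category
begin

text \<open>
  A factorisation through \<open>q\<close> is one through the column, by projecting to the second summand.  So
  a weak cokernel may be enlarged by any further component that \<open>f\<close> kills.
\<close>

lemma weak_cokernel_col:
  assumes f: "f \<in> Hom M A B" and p: "p \<in> Hom M B C" "f \<Zcomp> p = Null M A C"
    and q: "q \<in> Hom M B D" "is_weak_cokernel M f q"
  shows "is_weak_cokernel M f (col_mor M C D p q)"
proof -
  have obj: "A \<in> Obj M" "C \<in> Obj M" "D \<in> Obj M"
    using HomD f p(1) q(1) by blast+
  note wq = weak_cokernelD[OF q(2) f q(1)]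
  note P = Proj2_closed[OF obj(2,3)]
  show ?thesis
    unfolding is_weak_cokernel_iff[OF f col_closed[OF p(1) q(1)]]
  proof (intro conjI allI ballI impI)
    show "f \<Zcomp> col_mor M C D p q = Null M A (DSum M C D)"
      using Comp_col[OF p(1) q(1) f] col_Null[OF obj(2,3,1)] p(2) wq(1) by simp
    fix W w assume "w \<in> Hom M B W" "f \<Zcomp> w = Null M A W"
    then obtain k where k: "k \<in> Hom M D W" "w = q \<Zcomp> k"
      using wq(2) by blast
    then have "w = col_mor M C D p q \<Zcomp> (Proj2 M C D \<Zcomp> k)"
      using Comp_assoc[OF col_closed[OF p(1) q(1)] P k(1)] col_Proj2[OF p(1) q(1)] by simp
    then show "\<exists>k \<in> Hom M (DSum M C D) W. w = col_mor M C D p q \<Zcomp> k"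
      using Comp_closed[OF P k(1)] by blast
  qed
qed

lemma col_is_mono:
  assumes f: "f \<in> Hom M W A" and g: "g \<in> Hom M W B" and mono: "is_mono M f"
  shows "is_mono M (col_mor M A B f g)"
  unfolding is_mono_iff[OF col_closed[OF f g]]
proof (intro allI ballI impI)
  fix V h assume h: "h \<in> Hom M V W" and h0: "h \<Zcomp> col_mor M A B f g = Null M V (DSum M A B)"
  note P = Proj1_closed[OF HomD(2)[OF f] HomD(2)[OF g]]
  have "h \<Zcomp> f = Null M V A"
    using Comp_assoc[OF h col_closed[OF f g] P] Null_Comp[OF P HomD(1)[OF h]] h0
    by (simp add: col_Proj1[OF f g])
  then show "h = Null M V W"
    using mono h is_mono_iff[OF f] by blast
qed

lemma mono_Neg:
  assumes f: "f \<in> Hom M A B" and mono: "is_mono M f"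
  shows "is_mono M (\<boxminus> f)"
  using mono Comp_Neg[OF _ f] Neg_eq_Null_iff[OF Comp_closed[OF _ f]]
  by (simp add: is_mono_iff[OF f] is_mono_iff[OF Neg_closed[OF f]])

context
  fixes n m :: nat and X Y :: "nat \<Rightarrow> 'a" and dX dY F :: "nat \<Rightarrow> 'b"
  assumes X: "is_complex M n X dX" and F: "is_complex_morphism M m X dX Y dY F"
begin

lemma cone_components:
  shows "i \<le> n \<Longrightarrow> X i \<in> Obj M" and "i < n \<Longrightarrow> dX i \<in> Hom M (X i) (X (i + 1))"
    and "i + 1 < n \<Longrightarrow> dX i \<Zcomp> dX (i + 1) = Null M (X i) (X (i + 2))"
    and "i \<le> m \<Longrightarrow> Y i \<in> Obj M" and "i < m \<Longrightarrow> dY i \<in> Hom M (Y i) (Y (i + 1))"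
    and "i + 1 < m \<Longrightarrow> dY i \<Zcomp> dY (i + 1) = Null M (Y i) (Y (i + 2))"
    and "i \<le> m \<Longrightarrow> F i \<in> Hom M (X i) (Y i)"
    and "i < m \<Longrightarrow> dX i \<Zcomp> F (i + 1) = F i \<Zcomp> dY i"
  using X F by (simp_all add: is_complex_morphism_def is_complex_def is_sequence_def)

lemma cone_diff_closed:
  assumes j: "j < n" "j \<le> m"
  shows "cone_diff M n X dX Y dY F j \<in> Hom M (cone_obj M n X Y j) (DSum M (X (j + 1)) (Y j))"
proof (cases j)
  case 0
  have "col_mor M (X 1) (Y 0) (\<boxminus> (dX 0)) (F 0) \<in> Hom M (X 0) (DSum M (X 1) (Y 0))"
    using cone_components(2)[of 0] cone_components(7)[of 0] j 0
    by (intro col_closed Neg_closed) simp_all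
  then show ?thesis
    using 0 by (simp add: cone_diff_def cone_obj_def)
next
  case (Suc i)
  have "mat_mor M (X j) (Y i) (X (j + 1)) (Y j) (\<boxminus> (dX j)) (Null M (Y i) (X (j + 1))) (F j) (dY i)
      \<in> Hom M (DSum M (X j) (Y i)) (DSum M (X (j + 1)) (Y j))"
    using cone_components(2)[of j] cone_components(7)[of j] cone_components(5)[of i]
      cone_components(4)[of i] cone_components(1)[of "j + 1"] j Suc
    by (intro mat_closed Neg_closed Null_closed) simp_all
  then show ?thesis
    using j Suc by (simp add: cone_diff_def cone_obj_def)
qed

text \<open>
  The relation that links cones to morphisms of complexes: the two columns of the product are
  \<open>- dX j \<Zcomp> x + F j \<Zcomp> y\<close> and \<open>dY (j - 1) \<Zcomp> y\<close>.  Applied to \<open>x = F (j + 1)\<close> and \<open>y = dY j\<close> it yields the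
  next commutative square and the next relation in \<open>Y\<close>.
\<close>

lemma cone_diff_row_eq_Null_iff:
  assumes j: "j < n" "j \<le> m" and x: "x \<in> Hom M (X (j + 1)) W" and y: "y \<in> Hom M (Y j) W"
  shows "cone_diff M n X dX Y dY F j \<Zcomp> row_mor M (X (j + 1)) (Y j) x y =
      Null M (cone_obj M n X Y j) W \<longleftrightarrow>
    dX j \<Zcomp> x = F j \<Zcomp> y \<and> (j > 0 \<longrightarrow> dY (j - 1) \<Zcomp> y = Null M (Y (j - 1)) W)"
proof -
  note dXj = cone_components(2)[OF j(1)] and Fj = cone_components(7)[OF j(2)]
  have eq: "\<boxminus> (dX j) \<Zcomp> x \<boxplus> F j \<Zcomp> y = Null M (X j) W \<longleftrightarrow> dX j \<Zcomp> x = F j \<Zcomp> y"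
    unfolding Neg_Comp[OF dXj x] by (rule Neg_eq_iff[OF Comp_closed[OF dXj x] Comp_closed[OF Fj y]])
  show ?thesis
  proof (cases j)
    case 0
    then show ?thesis
      using col_row[OF Neg_closed[OF dXj] Fj x y] eq by (simp add: cone_diff_def cone_obj_def)
  next
    case (Suc i)
    have i: "Y i \<in> Obj M" "dY i \<in> Hom M (Y i) (Y j)" "X (j + 1) \<in> Obj M"
      using cone_components(4,5)[of i] cone_components(1)[of "j + 1"] j Suc by simp_all
    have "Null M (Y i) (X (j + 1)) \<Zcomp> x \<boxplus> dY i \<Zcomp> y = dY i \<Zcomp> y"
      using Null_Comp[OF x i(1)] Null_Plus[OF Comp_closed[OF i(2) y]] by simp
    then show ?thesis
      using mat_row_eq_Null_iff[OF Neg_closed[OF dXj] Null_closed[OF i(1,3)] Fj i(2) x y] eq j Suc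
      by (simp add: cone_diff_def cone_obj_def)
  qed
qed

lemma cone_diff_Suc:
  assumes "j + 1 < n"
  shows "cone_diff M n X dX Y dY F (j + 1) = col_mor M (X (j + 2)) (Y (j + 1))
    (row_mor M (X (j + 1)) (Y j) (\<boxminus> (dX (j + 1))) (Null M (Y j) (X (j + 2))))
    (row_mor M (X (j + 1)) (Y j) (F (j + 1)) (dY j))"
  using assms by (simp add: cone_diff_def mat_mor_def)

text \<open>
  The upper row of the next cone differential, with entries \<open>- dX (j + 1)\<close> and \<open>0\<close>, is killed by
  the present one since \<open>X\<close> is a complex; the lower row is a weak cokernel already.
\<close>

lemma cone_weak_cokernel:
  assumes j: "j + 1 < n" "j < m"
    and wc: "is_weak_cokernel M (cone_diff M n X dX Y dY F j)
      (row_mor M (X (j + 1)) (Y j) (F (j + 1)) (dY j))"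
  shows "is_weak_cokernel M (cone_diff M n X dX Y dY F j) (cone_diff M n X dX Y dY F (j + 1))"
  unfolding cone_diff_Suc[OF j(1)]
proof (rule weak_cokernel_col[OF cone_diff_closed _ _ _ wc])
  show "j < n" "j \<le> m"
    using j by simp_all
  have Xj: "X (j + 2) \<in> Obj M" and Yj: "Y j \<in> Obj M"
    and dX': "dX j \<in> Hom M (X j) (X (j + 1))" "dX (j + 1) \<in> Hom M (X (j + 1)) (X (j + 2))"
    and Fj: "F j \<in> Hom M (X j) (Y j)"
    using cone_components(1)[of "j + 2"] cone_components(4,7)[of j] cone_components(2)[of j]
      cone_components(2)[of "j + 1"] j by simp_all
  note N = Null_closed[OF Yj Xj]
  show "row_mor M (X (j + 1)) (Y j) (F (j + 1)) (dY j)
      \<in> Hom M (DSum M (X (j + 1)) (Y j)) (Y (j + 1))"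
    using cone_components(7)[of "j + 1"] cone_components(5)[of j] j by (intro row_closed) simp_all
  show "row_mor M (X (j + 1)) (Y j) (\<boxminus> (dX (j + 1))) (Null M (Y j) (X (j + 2)))
      \<in> Hom M (DSum M (X (j + 1)) (Y j)) (X (j + 2))"
    using row_closed[OF Neg_closed[OF dX'(2)] N] .
  have "dX j \<Zcomp> \<boxminus> (dX (j + 1)) = F j \<Zcomp> Null M (Y j) (X (j + 2))"
    using cone_components(3)[OF j(1)] Comp_Neg[OF dX'] Comp_Null[OF Fj Xj]
      Neg_Null[OF HomD(1)[OF dX'(1)] Xj] by simp
  moreover have "dY (j - 1) \<Zcomp> Null M (Y j) (X (j + 2)) = Null M (Y (j - 1)) (X (j + 2))" if "j > 0"
    using Comp_Null[OF _ Xj] cone_components(5)[of "j - 1"] j that by simp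
  ultimately show "cone_diff M n X dX Y dY F j \<Zcomp>
      row_mor M (X (j + 1)) (Y j) (\<boxminus> (dX (j + 1))) (Null M (Y j) (X (j + 2))) =
      Null M (cone_obj M n X Y j) (X (j + 2))"
    using cone_diff_row_eq_Null_iff[OF _ _ Neg_closed[OF dX'(2)] N] j by simp
qed

end

text \<open>
  Any weak cokernel \<open>q\<close> of the cone differential at \<open>m\<close> continues the construction: its target is
  the next object and its two entries are the next components.  The same step is taken with a
  merely weak cokernel below degree \<open>n\<close> and with an epimorphism in degree \<open>n\<close>.
\<close>

lemma partial_n_pushout_extend:
  assumes X: "is_complex M n X dX" and m: "m < n"
    and po: "is_partial_n_pushout M n m X dX f Y dY F"
    and q: "q \<in> Hom M (DSum M (X (m + 1)) (Y m)) C"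
      "is_weak_cokernel M (cone_diff M n X dX Y dY F m) q"
  shows "is_partial_n_pushout M n (m + 1) X dX f (Y(m + 1 := C))
    (dY(m := Inj2 M (X (m + 1)) (Y m) \<Zcomp> q)) (F(m + 1 := Inj1 M (X (m + 1)) (Y m) \<Zcomp> q))"
    (is "is_partial_n_pushout M n _ X dX f ?Y ?dY ?F")
proof -
  have F: "is_complex_morphism M m X dX Y dY F" "F 0 = f"
    and wc: "\<And>j. j < m \<Longrightarrow> is_weak_cokernel M (cone_diff M n X dX Y dY F j)
      (row_mor M (X (j + 1)) (Y j) (F (j + 1)) (dY j))"
    using po by (auto simp: is_partial_n_pushout_def)
  note comp = cone_components[OF X F(1)]
  have o: "X (m + 1) \<in> Obj M" "Y m \<in> Obj M"
    using comp(1)[of "m + 1"] comp(4)[of m] m by simp_all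
  let ?a = "Inj1 M (X (m + 1)) (Y m) \<Zcomp> q" and ?b = "Inj2 M (X (m + 1)) (Y m) \<Zcomp> q"
  have a: "?a \<in> Hom M (X (m + 1)) C" and b: "?b \<in> Hom M (Y m) C"
    using Comp_closed[OF Inj1_closed[OF o] q(1)] Comp_closed[OF Inj2_closed[OF o] q(1)] by simp_all
  have row: "row_mor M (X (m + 1)) (Y m) ?a ?b = q"
    by (rule row_Inj_Comp[OF o q(1)])
  \<comment> \<open>These differentials involve neither degree \<open>m + 1\<close> of \<open>Y\<close> and \<open>F\<close> nor degree \<open>m\<close> of \<open>dY\<close>.\<close>
  have cd: "cone_diff M n X dX ?Y ?dY ?F j = cone_diff M n X dX Y dY F j" if "j \<le> m" for j
    using that by (auto simp: cone_diff_def)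
  have "cone_diff M n X dX Y dY F m \<Zcomp> q = Null M (cone_obj M n X Y m) C"
    using weak_cokernelD(1)[OF q(2) cone_diff_closed[OF X F(1) m order_refl] q(1)] .
  then have sq: "dX m \<Zcomp> ?a = F m \<Zcomp> ?b"
    and cx: "m > 0 \<Longrightarrow> dY (m - 1) \<Zcomp> ?b = Null M (Y (m - 1)) C"
    using cone_diff_row_eq_Null_iff[OF X F(1) m order_refl a b] unfolding row by simp_all
  have Y_complex: "is_complex M (m + 1) ?Y ?dY"
  proof -
    have "?dY i \<Zcomp> ?dY (i + 1) = Null M (?Y i) (?Y (i + 2))" if "i + 1 < m + 1" for i
    proof (cases "i + 1 = m")
      case True
      then show ?thesis
        using cx by (simp add: True[symmetric])
    next
      case False
      then show ?thesis
        using comp(6)[of i] that by simp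
    qed
    moreover have "?Y i \<in> Obj M" if "i \<le> m + 1" for i
      using comp(4)[of i] HomD(2)[OF a] that by auto
    moreover have "?dY i \<in> Hom M (?Y i) (?Y (i + 1))" if "i < m + 1" for i
      using comp(5)[of i] b that by auto
    ultimately show ?thesis
      by (simp add: is_complex_def is_sequence_def)
  qed
  have X_complex: "is_complex M (m + 1) X dX"
    using comp(1-3) m by (simp add: is_complex_def is_sequence_def)
  have "?F i \<in> Hom M (X i) (?Y i)" if "i \<le> m + 1" for i
    using comp(7)[of i] a that by auto
  moreover have "dX i \<Zcomp> ?F (i + 1) = ?F i \<Zcomp> ?dY i" if "i < m + 1" for i
    using comp(8)[of i] sq that by auto
  ultimately have "is_complex_morphism M (m + 1) X dX ?Y ?dY ?F"
    using X_complex Y_complex by (simp add: is_complex_morphism_def)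
  moreover have "?F 0 = f"
    using F(2) by simp
  moreover have "is_weak_cokernel M (cone_diff M n X dX ?Y ?dY ?F j)
      (row_mor M (X (j + 1)) (?Y j) (?F (j + 1)) (?dY j))" if "j < m + 1" for j
  proof (cases "j = m")
    case True
    then show ?thesis
      using q(2) row cd[of m] by simp
  next
    case False
    then show ?thesis
      using wc[of j] cd[of j] that by simp
  qed
  ultimately show ?thesis
    unfolding is_partial_n_pushout_def by blast
qed

lemma partial_n_pushout_exists:
  assumes coker: "has_n_cokernels M n" and X: "is_complex M n X dX" and f: "f \<in> Hom M (X 0) Y0"
    and m: "m < n"
  shows "\<exists>Y dY F. Y 0 = Y0 \<and> is_partial_n_pushout M n m X dX f Y dY F"
  using m
proof (induction m)
  case 0
  \<comment> \<open>In degree \<open>0\<close> alone there are no differentials, so \<open>dY\<close> is arbitrary.\<close>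
  have "is_complex_morphism M 0 X dX (\<lambda>_. Y0) undefined (\<lambda>_. f)"
    using X f HomD[OF f] by (simp add: is_complex_morphism_def is_complex_def is_sequence_def)
  then have "is_partial_n_pushout M n 0 X dX f (\<lambda>_. Y0) undefined (\<lambda>_. f)"
    by (simp add: is_partial_n_pushout_def)
  then show ?case
    by (intro exI[of _ "\<lambda>_. Y0"] exI conjI refl)
next
  case (Suc m)
  then obtain Y dY F where Y: "Y 0 = Y0" and po: "is_partial_n_pushout M n m X dX f Y dY F"
    by auto
  have m: "m < n" and n: "n \<ge> 1"
    using Suc.prems by simp_all
  have F: "is_complex_morphism M m X dX Y dY F"
    using po by (simp add: is_partial_n_pushout_def)
  obtain C q where "q \<in> Hom M (DSum M (X (m + 1)) (Y m)) C"
      "is_weak_cokernel M (cone_diff M n X dX Y dY F m) q"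
    using weak_cokernel_first[OF coker n cone_diff_closed[OF X F m order_refl]] by blast
  from partial_n_pushout_extend[OF X m po this] show ?case
    using Y by (intro exI conjI) auto
qed

text \<open>
  The construction is carried to degree \<open>n - 1\<close> with weak cokernels.  The differentials of the cone
  with indices below \<open>n\<close> are then a sequence of weak cokernels, so the last of them has a cokernel,
  and this one supplies degree \<open>n\<close>.
\<close>

lemma n_pushout_exists:
  assumes n: "n \<ge> 1" and split: "idempotent_complete M" and coker: "has_n_cokernels M n"
    and X: "is_complex M n X dX" and f: "f \<in> Hom M (X 0) Y0"
  shows "\<exists>Y dY F. Y 0 = Y0 \<and> is_n_pushout M n X dX f Y dY F"
proof -
  obtain m where m: "n = m + 1"
    using n by (metis add.commute le_Suc_ex)
  obtain Y dY F where Y: "Y 0 = Y0" and po: "is_partial_n_pushout M n m X dX f Y dY F"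
    using partial_n_pushout_exists[OF coker X f, of m] m by auto
  have F: "is_complex_morphism M m X dX Y dY F"
    using po by (simp add: is_partial_n_pushout_def)
  let ?C = "cone_obj M n X Y" and ?d = "cone_diff M n X dX Y dY F"
  have d: "?d j \<in> Hom M (?C j) (?C (j + 1))" if "j < n" for j
    using cone_diff_closed[OF X F that] that m by (simp add: cone_obj_def)
  then have seq: "is_sequence M n ?C ?d"
    using HomD(1)[OF d] HomD(2)[OF d[of m]] m by (auto simp: is_sequence_def le_less)
  have wc: "is_weak_cokernel M (?d j) (?d (j + 1))" if "j + 1 < n" for j
    using cone_weak_cokernel[OF X F that] po that m by (simp add: is_partial_n_pushout_def)
  obtain C q where q: "q \<in> Hom M (?C n) C" "is_weak_cokernel M (?d (n - 1)) q" "is_epi M q"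
    using weak_cokernels_last_cokernel[OF split coker n seq wc] by blast
  have Cn: "?C n = DSum M (X (m + 1)) (Y m)"
    by (simp add: cone_obj_def m)
  have q': "q \<in> Hom M (DSum M (X (m + 1)) (Y m)) C" "is_weak_cokernel M (?d m) q"
    using q(1,2) Cn m by simp_all
  let ?Y = "Y(m + 1 := C)" and ?dY = "dY(m := Inj2 M (X (m + 1)) (Y m) \<Zcomp> q)"
    and ?F = "F(m + 1 := Inj1 M (X (m + 1)) (Y m) \<Zcomp> q)"
  have "is_partial_n_pushout M n n X dX f ?Y ?dY ?F"
    using partial_n_pushout_extend[OF X _ po q'] m by simp
  then have F': "is_complex_morphism M n X dX ?Y ?dY ?F" "?F 0 = f"
    and wc': "\<And>j. j < n \<Longrightarrow> is_weak_cokernel M (cone_diff M n X dX ?Y ?dY ?F j)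
      (row_mor M (X (j + 1)) (?Y j) (?F (j + 1)) (?dY j))"
    by (simp_all only: is_partial_n_pushout_def)
  let ?C' = "cone_obj M n X ?Y" and ?d' = "cone_diff M n X dX ?Y ?dY ?F"
  have last: "?d' n = row_mor M (X (m + 1)) (Y m) (?F (m + 1)) (?dY m)"
    by (simp add: cone_diff_def m)
  also have "\<dots> = q"
    using row_Inj_Comp[OF _ _ q'(1)] cone_components(1)[OF X F, of "m + 1"]
      cone_components(4)[OF X F, of m] m by simp
  finally have dn: "?d' n = q" .
  have d': "?d' j \<in> Hom M (?C' j) (?C' (j + 1))" if "j < n + 1" for j
  proof (cases "j = n")
    case True
    then show ?thesis
      using dn q'(1) m by (simp add: cone_obj_def)
  next
    case False
    then show ?thesis
      using cone_diff_closed[OF X F'(1), of j] that by (simp add: cone_obj_def)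
  qed
  then have seq': "is_sequence M (n + 1) ?C' ?d'"
    using HomD(1)[OF d'] HomD(2)[OF d'[of n]] by (auto simp: is_sequence_def le_less)
  have "is_weak_cokernel M (?d' j) (?d' (j + 1))" if "j < n" for j
  proof (cases "j + 1 = n")
    case True
    then show ?thesis
      using wc'[of m] last m by simp
  next
    case False
    then show ?thesis
      using cone_weak_cokernel[OF X F'(1), of j] wc'[of j] that by simp
  qed
  then have "is_n_cokernel M n ?C' ?d'"
    using is_n_cokernel_iff[OF seq'] dn q(3) by simp
  then have "is_n_pushout M n X dX f ?Y ?dY ?F"
    using F' by (simp only: is_n_pushout_def)
  then show ?thesis
    using Y by (intro exI conjI) auto
qed

end

text \<open>
  The column with entries \<open>0\<close> and \<open>g\<close> turns a relation \<open>g \<Zcomp> dY 0 = 0\<close> into one about the second cone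
  differential, where the weak kernel property of the first one applies.
\<close>

lemma (in n_abelian_category) n_pushout_mono:
  assumes n: "n \<ge> 1" and po: "is_n_pushout M n X dX f Y dY F" and mono: "is_mono M (dX 0)"
  shows "is_mono M (dY 0)"
proof -
  let ?C = "cone_obj M n X Y" and ?d = "cone_diff M n X dX Y dY F"
  have F: "is_complex_morphism M n X dX Y dY F" and coker: "is_n_cokernel M n ?C ?d"
    using po by (simp_all add: is_n_pushout_def)
  have X: "is_complex M n X dX"
    using F by (simp add: is_complex_morphism_def)
  note comp = cone_components[OF X F]
  have dX0: "dX 0 \<in> Hom M (X 0) (X 1)" and dY0: "dY 0 \<in> Hom M (Y 0) (Y 1)"
    and F0: "F 0 \<in> Hom M (X 0) (Y 0)" and F1: "F 1 \<in> Hom M (X 1) (Y 1)"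
    using comp(2)[of 0] comp(5)[of 0] comp(7)[of 0] comp(7)[of 1] n by simp_all
  have o: "X 1 \<in> Obj M" "Y 0 \<in> Obj M"
    using HomD dX0 dY0 by blast+
  have d0: "?d 0 = col_mor M (X 1) (Y 0) (\<boxminus> (dX 0)) (F 0)"
    by (simp add: cone_diff_def)
  have "is_mono M (?d 0)"
    unfolding d0 by (rule col_is_mono[OF Neg_closed[OF dX0] F0 mono_Neg[OF dX0 mono]])
  then have ker: "is_n_kernel M n ?C ?d"
    using A2[OF _ coker] by (simp add: is_n_exact_def)
  have C0: "?C 0 = X 0" and C1: "?C 1 = DSum M (X 1) (Y 0)"
    using n by (simp_all add: cone_obj_def)
  have kernel_trivial: "g = Null M W (Y 0)"
    if g: "g \<in> Hom M W (Y 0)" and gd: "g \<Zcomp> dY 0 = Null M W (Y 1)" for W g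
  proof -
    have W: "W \<in> Obj M"
      using HomD(1)[OF g] .
    note N = Null_closed[OF W o(1)]
    let ?r = "row_mor M (X 1) (Y 0) (F 1) (dY 0)" and ?h = "col_mor M (X 1) (Y 0) (Null M W (X 1)) g"
    have h: "?h \<in> Hom M W (DSum M (X 1) (Y 0))"
      by (rule col_closed[OF N g])
    have hr: "?h \<Zcomp> ?r = Null M W (Y 1)"
      using col_row[OF N g F1 dY0] gd Null_Comp[OF F1 W] Plus_Null[OF Null_closed[OF W HomD(2)[OF F1]]]
      by simp
    \<comment> \<open>For \<open>n = 1\<close> the second differential is the last one and consists of the row \<open>?r\<close> only.\<close>
    have "?h \<Zcomp> ?d 1 = Null M W (?C 2)"
    proof (cases "n = 1")
      case True
      then show ?thesis
        using hr by (simp add: cone_diff_def cone_obj_def)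
    next
      case False
      then have n2: "0 + 1 < n"
        using n by simp
      have X2: "X 2 \<in> Obj M" and dX1: "dX 1 \<in> Hom M (X 1) (X 2)"
        using comp(1)[of 2] comp(2)[of 1] n2 by (simp_all add: numeral_2_eq_2)
      note N2 = Null_closed[OF o(2) X2]
      let ?s = "row_mor M (X 1) (Y 0) (\<boxminus> (dX 1)) (Null M (Y 0) (X 2))"
      have s: "?s \<in> Hom M (DSum M (X 1) (Y 0)) (X 2)"
        by (rule row_closed[OF Neg_closed[OF dX1] N2])
      have "?h \<Zcomp> ?s = Null M W (X 2)"
        using col_row[OF N g Neg_closed[OF dX1] N2] Null_Comp[OF Neg_closed[OF dX1] W]
          Comp_Null[OF g X2] Plus_Null[OF Null_closed[OF W X2]] by simp
      then have "?h \<Zcomp> col_mor M (X 2) (Y 1) ?s ?r = Null M W (DSum M (X 2) (Y 1))"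
        using Comp_col[OF s row_closed[OF F1 dY0] h] hr col_Null[OF X2 HomD(2)[OF F1] W] by simp
      then show ?thesis
        using cone_diff_Suc[OF X F n2] n2 by (simp add: cone_obj_def numeral_2_eq_2)
    qed
    then obtain k where k: "k \<in> Hom M W (X 0)" "k \<Zcomp> ?d 0 = ?h"
      using n_kernel_first_lift[OF ker n, of ?h W] h C0 C1 by auto
    have kd: "k \<Zcomp> \<boxminus> (dX 0) = Null M W (X 1)" and kF: "k \<Zcomp> F 0 = g"
    proof -
      have eq: "col_mor M (X 1) (Y 0) (k \<Zcomp> \<boxminus> (dX 0)) (k \<Zcomp> F 0) = ?h"
        using k(2) Comp_col[OF Neg_closed[OF dX0] F0 k(1)] d0 by simp
      note c = Comp_closed[OF k(1) Neg_closed[OF dX0]] Comp_closed[OF k(1) F0]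
      show "k \<Zcomp> \<boxminus> (dX 0) = Null M W (X 1)"
        using col_Proj1[OF c] col_Proj1[OF N g] eq by simp
      show "k \<Zcomp> F 0 = g"
        using col_Proj2[OF c] col_Proj2[OF N g] eq by simp
    qed
    have "k = Null M W (X 0)"
      using mono_Neg[OF dX0 mono] k(1) kd is_mono_iff[OF Neg_closed[OF dX0]] by blast
    then show ?thesis
      using kF Null_Comp[OF F0 W] by simp
  qed
  then show ?thesis
    using is_mono_iff[OF dY0] by blast
qed

theorem theorem3p8:
  fixes M :: "('o, 'm, 'b) precat_scheme"
    and n :: nat
    and X :: "nat \<Rightarrow> 'o" and dX :: "nat \<Rightarrow> 'm"
    and Y0 :: 'o and f :: 'm
  assumes "n \<ge> 1"
    and "additive_category M"
    and "idempotent_complete M"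
    and "has_n_kernels M n" and "has_n_cokernels M n"
    and "is_complex M n X dX"
    and "f \<in> Hom M (X 0) Y0"
  shows "(\<exists>Y dY F. Y 0 = Y0 \<and> is_n_pushout M n X dX f Y dY F) \<and>
    (n_abelian_category M n \<longrightarrow> is_mono M (dX 0) \<longrightarrow>
      (\<forall>Y dY F. Y 0 = Y0 \<and> is_n_pushout M n X dX f Y dY F \<longrightarrow> is_mono M (dY 0)))"
proof (intro conjI impI allI)
  show "\<exists>Y dY F. Y 0 = Y0 \<and> is_n_pushout M n X dX f Y dY F"
    using additive_category.n_pushout_exists[OF assms(2,1,3,5-7)] .
  fix Y dY F
  assume ab: "n_abelian_category M n" and mono: "is_mono M (dX 0)"
    and po: "Y 0 = Y0 \<and> is_n_pushout M n X dX f Y dY F"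
  show "is_mono M (dY 0)"
    by (rule n_abelian_category.n_pushout_mono[OF ab assms(1) conjunct2[OF po] mono])
qed

end
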